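(* Let $n,m,p$ be positive integers. Let $A_{11}\in\mathbb{R}^{n\times n}$ and $A_{22}\in\mathbb{R}^{m\times m}$ be symmetric positive definite, let $A_{12}\in\mathbb{R}^{n\times m}$ and set $A_{21}=-A_{12}^T$, let $B\in\mathbb{R}^{p\times m}$ have full row rank, let $Q\in\mathbb{R}^{p\times p}$ be symmetric positive definite, and let $\gamma,\alpha$ be real parameters with $\alpha\ge\gamma>0$. Define \[ \bar{\mathcal{A}}=\begin{bmatrix} A_{11} & A_{12} & 0\\ A_{21} & A_{22}+\gamma B^TQ^{-1}B & B^T\\ 0 & B & 0\end{bmatrix},\qquad \mathcal{P}_{\gamma,\alpha}=\begin{bmatrix} A_{11} & A_{12} & 0\\ 0 & A_{22}+\gamma B^TQ^{-1}B & (1-\gamma\alpha^{-1})B^T\\ 0 & B & -\alpha^{-1}Q\end{bmatrix}. \] Then all eigenvalues of $\mathcal{P}_{\gamma,\alpha}^{-1}\bar{\mathcal{A}}$ are real and positive. More precisely, every eigenvalue $\lambda$ of $\mathcal{P}_{\gamma,\alpha}^{-1}\bar{\mathcal{A}}$ satisfies \[ \frac{\xi^2\,\alpha\,\lambda_{\min}(Q)}{\lambda_{\max}(Q)\Big(\big(\lambda_{\max}(A_{22})+\lambda_{\max}(A_{12}^TA_{11}^{-1}A_{12})\big)\lambda_{\min}(Q)+2\alpha\|B\|_2^2\Big)}\;\le\;\lambda\;<\;2+\frac{\lambda_{\max}(A_{12}^TA_{11}^{-1}A_{12})}{\lambda_{\min}(A_{22})}, \] where $\xi=\min\{\|By\|_2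 \,:\, y\notin \mathrm{Ker}(B),\ y^*y=1\}$.
   Context: For a square matrix with real spectrum, $\lambda_{\min}(\cdot)$ and $\lambda_{\max}(\cdot)$ denote its smallest and largest eigenvalues. $\|B\|_2$ is the spectral norm of $B$, $\mathrm{Ker}(B)$ its null space, and $y^*$ the conjugate transpose of the (possibly complex) vector $y\in\mathbb{C}^m$.
   Formalization: The minimum defining ξ is replaced by an infimum, since for m > p the kernel of B is nontrivial and the minimum is not attained; in that case ξ = 0 and the lower bound reads 0 ≤ λ, while for m = p the infimum is the minimum. *)

theory Defs
  imports "Jordan_Normal_Form.Char_Poly" "Jordan_Normal_Form.Gauss_Jordan_Elimination"
          "Jordan_Normal_Form.DL_Rank" "Jordan_Normal_Form.Matrix_Kernel"
begin

(* matrix inverse (meaningful for invertible square matrices) *)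
definition mat_inv :: "real mat \<Rightarrow> real mat" where
  "mat_inv M = the (mat_inverse M)"

definition hcat :: "real mat \<Rightarrow> real mat \<Rightarrow> real mat" where
  "hcat X Y = four_block_mat X Y (0\<^sub>m 0 (dim_col X)) (0\<^sub>m 0 (dim_col Y))"

definition block3 :: "real mat \<Rightarrow> real mat \<Rightarrow> real mat \<Rightarrow> real mat \<Rightarrow> real mat \<Rightarrow> real mat
    \<Rightarrow> real mat \<Rightarrow> real mat \<Rightarrow> real mat \<Rightarrow> real mat" where
  "block3 M11 M12 M13 M21 M22 M23 M31 M32 M33 =
     hcat M11 (hcat M12 M13) @\<^sub>r hcat M21 (hcat M22 M23) @\<^sub>r hcat M31 (hcat M32 M33)"

definition spd :: "nat \<Rightarrow> real mat \<Rightarrow> bool" where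
  "spd n M \<longleftrightarrow> M \<in> carrier_mat n n \<and> transpose_mat M = M \<and>
     (\<forall>x \<in> carrier_vec n. x \<noteq> 0\<^sub>v n \<longrightarrow> x \<bullet> (M *\<^sub>v x) > 0)"

(* smallest / largest eigenvalue of a square matrix with real spectrum *)
definition lambda_min :: "real mat \<Rightarrow> real" where
  "lambda_min M = Min {k. eigenvalue M k}"

definition lambda_max :: "real mat \<Rightarrow> real" where
  "lambda_max M = Max {k. eigenvalue M k}"

definition cnorm2 :: "complex vec \<Rightarrow> real" where
  "cnorm2 y = sqrt (\<Sum>i<dim_vec y. (cmod (y $ i))\<^sup>2)"

definition rnorm2 :: "real vec \<Rightarrow> real" where
  "rnorm2 x = sqrt (\<Sum>i<dim_vec x. (x $ i)\<^sup>2)"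

definition spec_norm :: "real mat \<Rightarrow> real" where
  "spec_norm B = Sup {rnorm2 (B *\<^sub>v x) | x. x \<in> carrier_vec (dim_col B) \<and> rnorm2 x = 1}"

definition xi_B :: "real mat \<Rightarrow> real" where
  "xi_B B = Inf {cnorm2 (map_mat complex_of_real B *\<^sub>v y) | y.
      y \<in> carrier_vec (dim_col B) \<and> y \<notin> mat_kernel (map_mat complex_of_real B) \<and>
      (\<Sum>i<dim_vec y. cnj (y $ i) * y $ i) = 1}"

end

(* With y the second component of an eigenvector for an eigenvalue l other than 1, the first and
   third block rows express x and z through y.  Pairing the remaining row with y gives
     l^2 (a + c) - l (k + a + 2 c) + c = 0,
   where a = y* A22 y, k = y* K y >= 0 with K = A12^T A11^-1 A12, and
   c = alpha (B y)* Q^-1 (B y) >= 0; the parameter gamma cancels.  The discriminant is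
   (k + a)^2 + 4 c k > 0, so l is real, and l > 0 since l = 0 is excluded by the full row rank of B.
   The equation yields c / (k + a + 2 c) <= l < 2 + k / a, and Rayleigh quotient estimates of
   a, k and c give the stated bounds. *)
theory Submission
  imports Defs
begin

section \<open>Rayleigh quotients of real symmetric matrices\<close>

text \<open>Realness of l is a claim, so y has to be allowed complex. The matrices in the forms are
  real symmetric, hence y* M y is the real form at Re y plus the real form at Im y, and real
  Rayleigh bounds suffice.

  Those bounds are the analytic obstacle: \<open>lambda_min\<close> and \<open>lambda_max\<close>
  are extremes of the set of real eigenvalues, so it must be shown that the extremes of the Rayleigh
  quotient are eigenvalues. A supremum and an invertibility argument achieve this without
  compactness or diagonalisation.

  For |y| = 1 the constant of the lower bound arises from c >= \<alpha> xi^2 / lambda_max(Q) and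
  from lambda_min(Q) (k + a + 2 c) being at most the large bracket of the denominator. Two cases
  escape this: for l = 1 the first row does not express x through y, and xi says nothing about y in
  Ker(B). In both cases l >= 1, while the constant is at most 1 because xi <= ||B||_2.\<close>

lemma scalar_prod_self_sum: "x \<bullet> x = (\<Sum>i<dim_vec x. (x $ i)\<^sup>2)" for x :: "real vec"
  by (simp add: scalar_prod_def power2_eq_square lessThan_atLeast0)

lemma scalar_prod_self_nonneg: "0 \<le> x \<bullet> x" for x :: "real vec"
  by (simp add: scalar_prod_self_sum sum_nonneg)

lemma scalar_prod_self_pos:
  fixes x :: "real vec"
  assumes "x \<in> carrier_vec n" "x \<noteq> 0\<^sub>v n"
  shows "0 < x \<bullet> x"
proof -
  obtain i where i: "i < n" "x $ i \<noteq> 0" using assms by (metis carrier_vecD eq_vecI index_zero_vec(1,2))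
  have "0 < (x $ i)\<^sup>2" using i by simp
  also have "\<dots> \<le> (\<Sum>i<dim_vec x. (x $ i)\<^sup>2)"
    by (rule member_le_sum) (use i assms in auto)
  finally show ?thesis by (simp add: scalar_prod_self_sum)
qed

text \<open>The vector (r . r) x - (r . x) r is a multiple of the component of x orthogonal to r;
  its squared norm is r . r times the defect of the inequality.\<close>

lemma scalar_prod_Cauchy:
  fixes r x :: "real vec"
  assumes r: "r \<in> carrier_vec n" and x: "x \<in> carrier_vec n"
  shows "(r \<bullet> x)\<^sup>2 \<le> (r \<bullet> r) * (x \<bullet> x)"
proof (cases "r = 0\<^sub>v n")
  case True
  thus ?thesis using x by simp
next
  case False
  let ?s = "r \<bullet> r" and ?t = "r \<bullet> x"
  have "0 \<le> (?s \<cdot>\<^sub>v x - ?t \<cdot>\<^sub>v r) \<bullet> (?s \<cdot>\<^sub>v x - ?t \<cdot>\<^sub>v r)"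
    by (rule scalar_prod_self_nonneg)
  also have "\<dots> = ?s * (?s * (x \<bullet> x) - ?t\<^sup>2)"
    using r x by (simp add: minus_scalar_prod_distrib[of _ n] scalar_prod_minus_distrib[of _ n]
      smult_scalar_prod_distrib[of _ n] scalar_prod_smult_distrib[of _ n]
      comm_scalar_prod[of x n r] power2_eq_square algebra_simps)
  finally show ?thesis using scalar_prod_self_pos[OF r False] by (simp add: zero_le_mult_iff)
qed

lemma mult_mat_vec_bound:
  fixes A :: "real mat"
  assumes A: "A \<in> carrier_mat r c"
  obtains C where "0 < C" "\<And>x. x \<in> carrier_vec c \<Longrightarrow> (A *\<^sub>v x) \<bullet> (A *\<^sub>v x) \<le> C * (x \<bullet> x)"
proof
  \<comment> \<open>The squared Frobenius norm; 1 is added below so that the constant is positive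
    for the zero matrix too.\<close>
  let ?C = "\<Sum>i<r. row A i \<bullet> row A i"
  show "0 < ?C + 1" by (intro add_nonneg_pos sum_nonneg scalar_prod_self_nonneg) simp
  fix x :: "real vec" assume x: "x \<in> carrier_vec c"
  have "(row A i \<bullet> x)\<^sup>2 \<le> (row A i \<bullet> row A i) * (x \<bullet> x)" if "i < r" for i
    by (rule scalar_prod_Cauchy[of _ c]) (use that A x in auto)
  hence "(A *\<^sub>v x) \<bullet> (A *\<^sub>v x) \<le> (\<Sum>i<r. (row A i \<bullet> row A i) * (x \<bullet> x))"
    using A by (auto simp: scalar_prod_self_sum[of "A *\<^sub>v x"] intro!: sum_mono)
  also have "\<dots> \<le> (?C + 1) * (x \<bullet> x)"
    by (simp add: sum_distrib_right[symmetric] scalar_prod_self_nonneg distrib_right)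
  finally show "(A *\<^sub>v x) \<bullet> (A *\<^sub>v x) \<le> (?C + 1) * (x \<bullet> x)" .
qed

lemma symmetric_scalar_prod:
  fixes M :: "real mat"
  assumes "M \<in> carrier_mat n n" "transpose_mat M = M" "x \<in> carrier_vec n" "y \<in> carrier_vec n"
  shows "x \<bullet> (M *\<^sub>v y) = y \<bullet> (M *\<^sub>v x)"
  using transpose_vec_mult_scalar[of M n n y x] assms
  by (metis comm_scalar_prod mult_mat_vec_carrier)

lemma smult_mat_mult_vec:
  fixes A :: "'a :: comm_ring mat"
  assumes "A \<in> carrier_mat nr nc" "v \<in> carrier_vec nc"
  shows "(k \<cdot>\<^sub>m A) *\<^sub>v v = k \<cdot>\<^sub>v (A *\<^sub>v v)"
  using assms by (intro eq_vecI) (auto simp: row_smult)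

lemma mult_mat_vec_uminus:
  fixes A :: "'a :: ring mat"
  assumes "A \<in> carrier_mat r c" "v \<in> carrier_vec c"
  shows "A *\<^sub>v (- v) = - (A *\<^sub>v v)"
  using assms by (intro eq_vecI) (auto simp: scalar_prod_def sum_negf)

text \<open>A crude bound from 2 x . Mx <= x . x + Mx . Mx. It guarantees that the supremum of the
  Rayleigh quotient exists.\<close>

lemma scalar_prod_mult_mat_vec_le:
  fixes M :: "real mat"
  assumes M: "M \<in> carrier_mat n n"
  obtains C where "0 < C" "\<And>x. x \<in> carrier_vec n \<Longrightarrow> x \<bullet> (M *\<^sub>v x) \<le> C * (x \<bullet> x)"
proof -
  obtain C where C: "0 < C" "\<And>x. x \<in> carrier_vec n \<Longrightarrow> (M *\<^sub>v x) \<bullet> (M *\<^sub>v x) \<le> C * (x \<bullet> x)"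
    using mult_mat_vec_bound[OF M] by blast
  show ?thesis
  proof
    show "0 < C + 1" using C(1) by simp
    fix x :: "real vec" assume x: "x \<in> carrier_vec n"
    let ?w = "M *\<^sub>v x"
    have w: "?w \<in> carrier_vec n" using M x by simp
    have "0 \<le> (x - ?w) \<bullet> (x - ?w)" by (rule scalar_prod_self_nonneg)
    also have "\<dots> = x \<bullet> x - 2 * (x \<bullet> ?w) + ?w \<bullet> ?w"
      using x w by (simp add: minus_scalar_prod_distrib[of _ n] scalar_prod_minus_distrib[of _ n]
        comm_scalar_prod[of ?w n x])
    finally have "2 * (x \<bullet> ?w) \<le> (C + 1) * (x \<bullet> x)" using C(2)[OF x] by (simp add: distrib_right)
    moreover have "0 \<le> (C + 1) * (x \<bullet> x)"
      using C(1) scalar_prod_self_nonneg[of x] by simp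
    ultimately show "x \<bullet> (M *\<^sub>v x) \<le> (C + 1) * (x \<bullet> x)" by linarith
  qed
qed

text \<open>For a semidefinite form a small value at x forces a small image \<open>N\<close> x:
  otherwise a step from x along - \<open>N\<close> x would make the form negative.\<close>

lemma psd_mult_mat_vec_bound:
  fixes N :: "real mat"
  assumes N: "N \<in> carrier_mat n n" "transpose_mat N = N"
    and psd: "\<And>x. x \<in> carrier_vec n \<Longrightarrow> 0 \<le> x \<bullet> (N *\<^sub>v x)"
  obtains C where "0 < C"
    "\<And>x. x \<in> carrier_vec n \<Longrightarrow> (N *\<^sub>v x) \<bullet> (N *\<^sub>v x) \<le> C * (x \<bullet> (N *\<^sub>v x))"
proof -
  obtain C where C: "0 < C" "\<And>x. x \<in> carrier_vec n \<Longrightarrow> x \<bullet> (N *\<^sub>v x) \<le> C * (x \<bullet> x)"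
    using scalar_prod_mult_mat_vec_le[OF N(1)] by blast
  show ?thesis
  proof
    show "0 < C" by fact
    fix x :: "real vec" assume x: "x \<in> carrier_vec n"
    \<comment> \<open>The step length -1/C minimises 2 t (w . w) + t^2 C (w . w), the estimate for
      the change of the form along w.\<close>
    let ?w = "N *\<^sub>v x" and ?t = "- (1 / C)"
    have w: "?w \<in> carrier_vec n" and Nw: "N *\<^sub>v ?w \<in> carrier_vec n" using N x by simp_all
    have "0 \<le> (x + ?t \<cdot>\<^sub>v ?w) \<bullet> (N *\<^sub>v (x + ?t \<cdot>\<^sub>v ?w))"
      by (rule psd) (use x w in simp)
    also have "N *\<^sub>v (x + ?t \<cdot>\<^sub>v ?w) = ?w + ?t \<cdot>\<^sub>v (N *\<^sub>v ?w)"
      using N x w by (simp add: mult_add_distrib_mat_vec[of _ n n] mult_mat_vec[of _ n n])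
    also have "(x + ?t \<cdot>\<^sub>v ?w) \<bullet> \<dots> = x \<bullet> ?w + 2 * ?t * (?w \<bullet> ?w) + ?t\<^sup>2 * (?w \<bullet> (N *\<^sub>v ?w))"
      using x w Nw symmetric_scalar_prod[OF N x w]
      by (simp add: add_scalar_prod_distrib[of _ n] scalar_prod_add_distrib[of _ n]
          smult_scalar_prod_distrib[of _ n] scalar_prod_smult_distrib[of _ n] power2_eq_square
          algebra_simps diff_divide_distrib)
    also have "\<dots> \<le> x \<bullet> ?w + 2 * ?t * (?w \<bullet> ?w) + ?t\<^sup>2 * (C * (?w \<bullet> ?w))"
      using C(2)[OF w] by (intro add_left_mono mult_left_mono) auto
    also have "\<dots> = x \<bullet> ?w - (?w \<bullet> ?w) / C"
      using C(1) by (simp add: power2_eq_square field_simps)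
    finally show "?w \<bullet> ?w \<le> C * (x \<bullet> ?w)" using C(1) by (simp add: field_simps)
  qed
qed

lemma eigenvalue_iff_vec:
  "M \<in> carrier_mat n n \<Longrightarrow>
    eigenvalue M c \<longleftrightarrow> (\<exists>v\<in>carrier_vec n. v \<noteq> 0\<^sub>v n \<and> M *\<^sub>v v = c \<cdot>\<^sub>v v)"
  by (auto simp: eigenvalue_def eigenvector_def)

text \<open>\<open>mat_inverse\<close> returns an option, and \<open>mat_inv\<close> applies
  \<open>the\<close> to it, so nothing is known about \<open>mat_inv\<close> until the result is
  shown to be \<open>Some\<close>. A trivial kernel gives this through the determinant.\<close>

lemma trivial_kernel_inverse:
  fixes M :: "'a :: field mat"
  assumes M: "M \<in> carrier_mat n n"
    and ker: "\<And>x. x \<in> carrier_vec n \<Longrightarrow> M *\<^sub>v x = 0\<^sub>v n \<Longrightarrow> x = 0\<^sub>v n"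
  obtains N where "mat_inverse M = Some N" "N \<in> carrier_mat n n" "M * N = 1\<^sub>m n" "N * M = 1\<^sub>m n"
proof -
  have "det M \<noteq> 0" using det_0_iff_vec_prod_zero_field[OF M] ker by auto
  hence "M \<in> Units (ring_mat TYPE('a) n ())" using det_non_zero_imp_unit[OF M] by simp
  hence "mat_inverse M \<noteq> None" using mat_inverse(1)[OF M, where b = "()"] by blast
  then obtain N where N: "mat_inverse M = Some N" by auto
  show ?thesis using that[OF N] mat_inverse(2)[OF M N] by auto
qed

text \<open>Let \<open>c\<close> be the supremum of the Rayleigh quotient of \<open>M\<close>, so \<open>N = c I - M\<close> is positive semidefinite.
  An invertible \<open>N\<close> would make the Rayleigh quotient of \<open>N\<close> bounded away from zero,
  contradicting the choice of \<open>c\<close>; hence \<open>c\<close> is an eigenvalue.\<close>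
lemma rayleigh_max:
  fixes M :: "real mat"
  assumes M: "M \<in> carrier_mat n n" "transpose_mat M = M" and n: "0 < n"
  obtains c where "eigenvalue M c" "\<And>x. x \<in> carrier_vec n \<Longrightarrow> x \<bullet> (M *\<^sub>v x) \<le> c * (x \<bullet> x)"
proof -
  define S where "S = {x \<bullet> (M *\<^sub>v x) / (x \<bullet> x) | x. x \<in> carrier_vec n \<and> x \<noteq> 0\<^sub>v n}"
  obtain C where C: "\<And>x. x \<in> carrier_vec n \<Longrightarrow> x \<bullet> (M *\<^sub>v x) \<le> C * (x \<bullet> x)"
    using scalar_prod_mult_mat_vec_le[OF M(1)] by metis
  have bdd: "bdd_above S"
    unfolding S_def using C scalar_prod_self_pos
    by (intro bdd_aboveI[of _ C]) (auto simp: pos_divide_le_eq)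
  have ne: "S \<noteq> {}" using n unit_vec_carrier[of n 0] unit_vec_nonzero[of 0 n]
    unfolding S_def by (auto intro!: exI[of _ "unit_vec n 0"])
  define c where "c = Sup S"
  have le: "x \<bullet> (M *\<^sub>v x) \<le> c * (x \<bullet> x)" if x: "x \<in> carrier_vec n" for x
  proof (cases "x = 0\<^sub>v n")
    case True thus ?thesis using M(1) by simp
  next
    case False
    hence "x \<bullet> (M *\<^sub>v x) / (x \<bullet> x) \<le> c"
      unfolding c_def S_def[symmetric] by (intro cSup_upper bdd) (use x S_def in auto)
    thus ?thesis using scalar_prod_self_pos[OF x False] by (simp add: pos_divide_le_eq)
  qed
  define N where "N = c \<cdot>\<^sub>m 1\<^sub>m n - M"
  have N: "N \<in> carrier_mat n n" unfolding N_def by (rule minus_carrier_mat) (rule M(1))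
  have N_vec: "N *\<^sub>v x = c \<cdot>\<^sub>v x - M *\<^sub>v x" if "x \<in> carrier_vec n" for x
    using M that by (auto simp: N_def minus_mult_distrib_mat_vec[of _ n n] smult_mat_mult_vec[of _ n n])
  have "transpose_mat (c \<cdot>\<^sub>m 1\<^sub>m n) = c \<cdot>\<^sub>m 1\<^sub>m n" by (rule eq_matI) auto
  hence Nsym: "transpose_mat N = N" using M by (simp add: N_def transpose_minus[of _ n n])
  have N_form: "x \<bullet> (N *\<^sub>v x) = c * (x \<bullet> x) - x \<bullet> (M *\<^sub>v x)" if x: "x \<in> carrier_vec n" for x
    using x M by (simp add: N_vec scalar_prod_minus_distrib[of _ n])
  have psd: "0 \<le> x \<bullet> (N *\<^sub>v x)" if "x \<in> carrier_vec n" for x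
    using le[OF that] N_form[OF that] by simp
  obtain D where D: "0 < D"
    "\<And>x. x \<in> carrier_vec n \<Longrightarrow> (N *\<^sub>v x) \<bullet> (N *\<^sub>v x) \<le> D * (x \<bullet> (N *\<^sub>v x))"
    using psd_mult_mat_vec_bound[OF N Nsym psd] by metis
  have "\<exists>v\<in>carrier_vec n. v \<noteq> 0\<^sub>v n \<and> N *\<^sub>v v = 0\<^sub>v n"
  proof (rule ccontr)
    assume "\<not> ?thesis"
    then obtain L where L: "L \<in> carrier_mat n n" "L * N = 1\<^sub>m n"
      using trivial_kernel_inverse[OF N] by metis
    obtain E where E: "0 < E" "\<And>x. x \<in> carrier_vec n \<Longrightarrow> (L *\<^sub>v x) \<bullet> (L *\<^sub>v x) \<le> E * (x \<bullet> x)"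
      using mult_mat_vec_bound[OF L(1)] by blast
    \<comment> \<open>\<open>E\<close> bounds x . x by Nx . Nx through the inverse, and
      \<open>D\<close> bounds Nx . Nx by the form of \<open>N\<close>; together they keep every
      Rayleigh quotient of \<open>N\<close> above 1 / (E D).\<close>
    have "s \<le> c - 1 / (E * D)" if "s \<in> S" for s
    proof -
      obtain x where x: "x \<in> carrier_vec n" "x \<noteq> 0\<^sub>v n" and s: "s = x \<bullet> (M *\<^sub>v x) / (x \<bullet> x)"
        using \<open>s \<in> S\<close> S_def by auto
      have "L *\<^sub>v (N *\<^sub>v x) = x" using L N x assoc_mult_mat_vec[of L n n N n x] by simp
      hence "x \<bullet> x \<le> E * ((N *\<^sub>v x) \<bullet> (N *\<^sub>v x))" using E(2)[of "N *\<^sub>v x"] N x by simp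
      also have "\<dots> \<le> E * (D * (x \<bullet> (N *\<^sub>v x)))" using D(2)[OF x(1)] E(1) by simp
      also have "\<dots> = E * D * (c * (x \<bullet> x) - x \<bullet> (M *\<^sub>v x))" by (simp add: N_form x)
      finally have "x \<bullet> x / (E * D) \<le> c * (x \<bullet> x) - x \<bullet> (M *\<^sub>v x)"
        using D(1) E(1) by (simp add: pos_divide_le_eq mult.commute)
      thus ?thesis unfolding s using scalar_prod_self_pos[OF x]
        by (simp add: pos_divide_le_eq left_diff_distrib)
    qed
    hence "c \<le> c - 1 / (E * D)" unfolding c_def by (intro cSup_least ne)
    thus False using mult_pos_pos[OF E(1) D(1)] by simp
  qed
  then obtain v where v: "v \<in> carrier_vec n" "v \<noteq> 0\<^sub>v n" "N *\<^sub>v v = 0\<^sub>v n" by auto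
  have "M *\<^sub>v v = c \<cdot>\<^sub>v v"
  proof (rule eq_vecI)
    fix i assume "i < dim_vec (c \<cdot>\<^sub>v v)"
    hence i: "i < n" using v by simp
    have "(c \<cdot>\<^sub>v v - M *\<^sub>v v) $ i = 0" using v N_vec i by simp
    thus "(M *\<^sub>v v) $ i = (c \<cdot>\<^sub>v v) $ i" using v M i by simp
  qed (use v M in simp)
  hence "eigenvalue M c" using v eigenvalue_iff_vec[OF M(1)] by auto
  thus ?thesis using le that by blast
qed

text \<open>\<open>Min\<close> and \<open>Max\<close> in \<open>lambda_min\<close> and
  \<open>lambda_max\<close> have their usual meaning only on finite sets. Eigenvalues are roots of
  the nonzero characteristic polynomial.\<close>

lemma finite_eigenvalues:
  fixes M :: "'a :: field mat"
  assumes "M \<in> carrier_mat n n"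
  shows "finite {k. eigenvalue M k}"
proof -
  have "char_poly M \<noteq> 0" using degree_monic_char_poly[OF assms] by auto
  thus ?thesis using poly_roots_finite eigenvalue_root_char_poly[OF assms] by auto
qed

lemma rayleigh_le_lambda_max:
  assumes M: "M \<in> carrier_mat n n" "transpose_mat M = M" "0 < n" and x: "x \<in> carrier_vec n"
  shows "x \<bullet> (M *\<^sub>v x) \<le> lambda_max M * (x \<bullet> x)"
proof -
  obtain c where c: "eigenvalue M c" "\<And>x. x \<in> carrier_vec n \<Longrightarrow> x \<bullet> (M *\<^sub>v x) \<le> c * (x \<bullet> x)"
    using rayleigh_max[OF M] by blast
  have "c \<le> lambda_max M" unfolding lambda_max_def
    using c finite_eigenvalues[OF M(1)] by (intro Max_ge) auto
  thus ?thesis using c(2)[OF x] scalar_prod_self_nonneg[of x]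
    by (meson mult_right_mono order_trans)
qed

text \<open>The maximum for \<open>- M\<close>, with the sign of its eigenvalue reversed.\<close>

lemma rayleigh_min:
  fixes M :: "real mat"
  assumes M: "M \<in> carrier_mat n n" "transpose_mat M = M" and n: "0 < n"
  obtains c where "eigenvalue M c" "\<And>x. x \<in> carrier_vec n \<Longrightarrow> c * (x \<bullet> x) \<le> x \<bullet> (M *\<^sub>v x)"
proof -
  have M': "- M \<in> carrier_mat n n" "transpose_mat (- M) = - M"
    using M(1) arg_cong[OF M(2), of uminus] by (simp_all add: transpose_uminus)
  obtain c where c: "eigenvalue (- M) c" "\<And>x. x \<in> carrier_vec n \<Longrightarrow> x \<bullet> (- M *\<^sub>v x) \<le> c * (x \<bullet> x)"
    using rayleigh_max[OF M' n] by blast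
  obtain v where v: "v \<in> carrier_vec n" "v \<noteq> 0\<^sub>v n" "- M *\<^sub>v v = c \<cdot>\<^sub>v v"
    using c eigenvalue_iff_vec[OF M'(1)] by auto
  have "M *\<^sub>v v = (- c) \<cdot>\<^sub>v v"
  proof (rule eq_vecI)
    fix i assume "i < dim_vec ((- c) \<cdot>\<^sub>v v)"
    hence i: "i < n" using v by simp
    have "(- M *\<^sub>v v) $ i = (c \<cdot>\<^sub>v v) $ i" using v by simp
    thus "(M *\<^sub>v v) $ i = ((- c) \<cdot>\<^sub>v v) $ i" using v(1) M(1) i by simp
  qed (use v M in simp)
  hence "eigenvalue M (- c)" using v eigenvalue_iff_vec[OF M(1)] by auto
  moreover have "- c * (x \<bullet> x) \<le> x \<bullet> (M *\<^sub>v x)" if "x \<in> carrier_vec n" for x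
    using c(2)[OF that] that M by simp
  ultimately show ?thesis using that by blast
qed

lemma lambda_min_le_rayleigh:
  assumes M: "M \<in> carrier_mat n n" "transpose_mat M = M" "0 < n" and x: "x \<in> carrier_vec n"
  shows "lambda_min M * (x \<bullet> x) \<le> x \<bullet> (M *\<^sub>v x)"
proof -
  obtain c where c: "eigenvalue M c" "\<And>x. x \<in> carrier_vec n \<Longrightarrow> c * (x \<bullet> x) \<le> x \<bullet> (M *\<^sub>v x)"
    using rayleigh_min[OF M] by blast
  have "lambda_min M \<le> c" unfolding lambda_min_def
    using c finite_eigenvalues[OF M(1)] by (intro Min_le) auto
  thus ?thesis using c(2)[OF x] scalar_prod_self_nonneg[of x]
    by (meson mult_right_mono order_trans)
qed

section \<open>Positive definite matrices and their inverses\<close>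

lemma spdD: "spd n M \<Longrightarrow> M \<in> carrier_mat n n" "spd n M \<Longrightarrow> transpose_mat M = M"
  by (simp_all add: spd_def)

lemma spd_eigenvalue_pos:
  assumes "spd n M" "eigenvalue M c"
  shows "0 < c"
proof -
  have M: "M \<in> carrier_mat n n" using assms by (simp add: spd_def)
  obtain v where v: "v \<in> carrier_vec n" "v \<noteq> 0\<^sub>v n" "M *\<^sub>v v = c \<cdot>\<^sub>v v"
    using assms eigenvalue_iff_vec[OF M] by auto
  have "0 < v \<bullet> (M *\<^sub>v v)" using assms(1) v(1,2) unfolding spd_def by blast
  also have "\<dots> = c * (v \<bullet> v)" using v by simp
  finally show ?thesis using scalar_prod_self_nonneg[of v] by (auto simp: zero_less_mult_iff)
qed

text \<open>A minimum belongs to its set only if the set is nonempty; the existence of a real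
  eigenvalue comes from \<open>rayleigh_min\<close>.\<close>

lemma spd_lambda_min_eigenvalue:
  assumes "spd n M" "0 < n"
  shows "eigenvalue M (lambda_min M)"
proof -
  have M: "M \<in> carrier_mat n n" "transpose_mat M = M" using assms by (simp_all add: spd_def)
  obtain c where c: "eigenvalue M c" using rayleigh_min[OF M assms(2)] by blast
  thus ?thesis unfolding lambda_min_def
    using Min_in[of "{k. eigenvalue M k}"] finite_eigenvalues[OF M(1)] by auto
qed

lemma spd_lambda_min_pos: "spd n M \<Longrightarrow> 0 < n \<Longrightarrow> 0 < lambda_min M"
  using spd_lambda_min_eigenvalue spd_eigenvalue_pos by blast

lemma spd_lambda_min_le_max:
  assumes "spd n M" "0 < n"
  shows "lambda_min M \<le> lambda_max M"
  unfolding lambda_max_def using assms spd_lambda_min_eigenvalue finite_eigenvalues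
  by (intro Max_ge) (auto simp: spd_def)

lemma spd_mat_inv:
  assumes "spd n M"
  shows "mat_inv M \<in> carrier_mat n n" "M * mat_inv M = 1\<^sub>m n" "mat_inv M * M = 1\<^sub>m n"
    "spd n (mat_inv M)"
proof -
  have M: "M \<in> carrier_mat n n" "transpose_mat M = M" using assms by (simp_all add: spd_def)
  have ker: "x = 0\<^sub>v n" if "x \<in> carrier_vec n" "M *\<^sub>v x = 0\<^sub>v n" for x
    using that assms by (auto simp: spd_def)
  have "mat_inv M \<in> carrier_mat n n \<and> M * mat_inv M = 1\<^sub>m n \<and> mat_inv M * M = 1\<^sub>m n"
    using trivial_kernel_inverse[OF M(1) ker] unfolding mat_inv_def by (metis option.sel)
  then show N: "mat_inv M \<in> carrier_mat n n" "M * mat_inv M = 1\<^sub>m n" "mat_inv M * M = 1\<^sub>m n"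
    by auto
  let ?N = "mat_inv M"
  have Nt: "transpose_mat ?N \<in> carrier_mat n n" using N by simp
  \<comment> \<open>Symmetry of the inverse: its transpose is a left inverse of \<open>M\<close>,
    and left and right inverses agree.\<close>
  have "transpose_mat ?N * M = 1\<^sub>m n"
    using transpose_mult[OF M(1) N(1)] M(2) N(2) by simp
  hence "transpose_mat ?N = ?N"
    using assoc_mult_mat[OF Nt M(1) N(1)] N(1,2) Nt by simp
  moreover have "0 < x \<bullet> (?N *\<^sub>v x)" if x: "x \<in> carrier_vec n" "x \<noteq> 0\<^sub>v n" for x
  proof -
    \<comment> \<open>With x = M w the form of the inverse at x becomes the form of \<open>M\<close>
      at w.\<close>
    let ?w = "?N *\<^sub>v x"
    have w: "?w \<in> carrier_vec n" "M *\<^sub>v ?w = x"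
      using M N x assoc_mult_mat_vec[of M n n ?N n x] by simp_all
    moreover have "M *\<^sub>v 0\<^sub>v n = 0\<^sub>v n" using M(1) by (intro eq_vecI) auto
    ultimately have "?w \<noteq> 0\<^sub>v n" using x(2) by metis
    hence "0 < ?w \<bullet> (M *\<^sub>v ?w)" using assms w(1) unfolding spd_def by blast
    thus ?thesis using w x by (simp add: comm_scalar_prod[of x n ?w])
  qed
  ultimately show "spd n ?N" using N by (simp add: spd_def)
qed

lemma eigenvalue_mat_inv:
  assumes M: "spd n M" and c: "eigenvalue (mat_inv M) c"
  shows "0 < c" "eigenvalue M (1 / c)"
proof -
  note N = spd_mat_inv[OF M]
  show pos: "0 < c" using spd_eigenvalue_pos[OF N(4) c] .
  have Mc: "M \<in> carrier_mat n n" using M by (simp add: spd_def)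
  obtain v where v: "v \<in> carrier_vec n" "v \<noteq> 0\<^sub>v n" "mat_inv M *\<^sub>v v = c \<cdot>\<^sub>v v"
    using c eigenvalue_iff_vec[OF N(1)] by auto
  have "v = M *\<^sub>v (mat_inv M *\<^sub>v v)"
    using assoc_mult_mat_vec[OF Mc N(1) v(1)] N v(1) by simp
  also have "\<dots> = c \<cdot>\<^sub>v (M *\<^sub>v v)" using v Mc by (simp add: mult_mat_vec)
  finally have "(1 / c) \<cdot>\<^sub>v v = (1 / c) \<cdot>\<^sub>v (c \<cdot>\<^sub>v (M *\<^sub>v v))" by simp
  hence "M *\<^sub>v v = (1 / c) \<cdot>\<^sub>v v" using pos by (simp add: smult_smult_assoc)
  thus "eigenvalue M (1 / c)" using v eigenvalue_iff_vec[OF Mc] by auto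
qed

text \<open>An extreme eigenvalue c of the inverse makes 1 / c an eigenvalue of \<open>M\<close>, so
  smallest and largest exchange their roles.\<close>

lemma mat_inv_rayleigh_bounds:
  assumes M: "spd n M" "0 < n" and x: "x \<in> carrier_vec n"
  shows "x \<bullet> (mat_inv M *\<^sub>v x) \<le> (x \<bullet> x) / lambda_min M"
    and "(x \<bullet> x) / lambda_max M \<le> x \<bullet> (mat_inv M *\<^sub>v x)"
proof -
  have Mc: "M \<in> carrier_mat n n" using M by (simp add: spd_def)
  note N = spd_mat_inv[OF M(1)]
  have Nsym: "transpose_mat (mat_inv M) = mat_inv M" using N(4) by (simp add: spd_def)
  obtain c where c: "eigenvalue (mat_inv M) c"
    "\<And>x. x \<in> carrier_vec n \<Longrightarrow> x \<bullet> (mat_inv M *\<^sub>v x) \<le> c * (x \<bullet> x)"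
    using rayleigh_max[OF N(1) Nsym M(2)] by blast
  note c' = eigenvalue_mat_inv[OF M(1) c(1)]
  have "lambda_min M \<le> 1 / c" unfolding lambda_min_def
    using c' finite_eigenvalues[OF Mc] by (intro Min_le) auto
  hence "c \<le> 1 / lambda_min M" using c' spd_lambda_min_pos[OF M] by (simp add: field_simps)
  hence "c * (x \<bullet> x) \<le> 1 / lambda_min M * (x \<bullet> x)"
    by (rule mult_right_mono) (rule scalar_prod_self_nonneg)
  thus "x \<bullet> (mat_inv M *\<^sub>v x) \<le> (x \<bullet> x) / lambda_min M" using c(2)[OF x] by simp
  obtain d where d: "eigenvalue (mat_inv M) d"
    "\<And>x. x \<in> carrier_vec n \<Longrightarrow> d * (x \<bullet> x) \<le> x \<bullet> (mat_inv M *\<^sub>v x)"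
    using rayleigh_min[OF N(1) Nsym M(2)] by blast
  note d' = eigenvalue_mat_inv[OF M(1) d(1)]
  have "1 / d \<le> lambda_max M" unfolding lambda_max_def
    using d' finite_eigenvalues[OF Mc] by (intro Max_ge) auto
  hence "1 / lambda_max M \<le> d"
    using d' less_le_trans[OF _ \<open>1 / d \<le> lambda_max M\<close>] by (simp add: field_simps)
  hence "1 / lambda_max M * (x \<bullet> x) \<le> d * (x \<bullet> x)"
    by (rule mult_right_mono) (rule scalar_prod_self_nonneg)
  thus "(x \<bullet> x) / lambda_max M \<le> x \<bullet> (mat_inv M *\<^sub>v x)" using d(2)[OF x] by simp
qed

text \<open>Both products C^T M C of the problem have this shape, with \<open>mat_inv A11\<close> or
  \<open>mat_inv Q\<close> in the middle; their forms are those of the inverses at the image of x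
  under \<open>C\<close>.\<close>

lemma congruence_form:
  fixes M C :: "real mat"
  assumes M: "M \<in> carrier_mat r r" "transpose_mat M = M" and C: "C \<in> carrier_mat r n"
  shows "transpose_mat (transpose_mat C * M * C) = transpose_mat C * M * C"
    and "x \<in> carrier_vec n \<Longrightarrow>
      x \<bullet> (transpose_mat C * M * C *\<^sub>v x) = (C *\<^sub>v x) \<bullet> (M *\<^sub>v (C *\<^sub>v x))"
proof -
  have CM: "transpose_mat C * M \<in> carrier_mat n r" using M C by simp
  have "transpose_mat (transpose_mat C * M * C) = transpose_mat C * (M * C)"
    using transpose_mult[OF CM C] transpose_mult[of "transpose_mat C" n r M r] M C by simp
  thus "transpose_mat (transpose_mat C * M * C) = transpose_mat C * M * C"
    using assoc_mult_mat[of "transpose_mat C" n r M r C n] M C by simp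
  assume x: "x \<in> carrier_vec n"
  have "x \<bullet> (transpose_mat C * M * C *\<^sub>v x) = x \<bullet> (transpose_mat C *\<^sub>v (M *\<^sub>v (C *\<^sub>v x)))"
    using M C x assoc_mult_mat_vec[OF CM C x]
      assoc_mult_mat_vec[of "transpose_mat C" n r M r "C *\<^sub>v x"] by simp
  also have "\<dots> = (transpose_mat C *\<^sub>v (M *\<^sub>v (C *\<^sub>v x))) \<bullet> x"
    by (rule comm_scalar_prod[of _ n]) (use M C x in auto)
  also have "\<dots> = (M *\<^sub>v (C *\<^sub>v x)) \<bullet> (C *\<^sub>v x)"
    by (rule transpose_vec_mult_scalar[OF C x]) (use M C x in auto)
  also have "\<dots> = (C *\<^sub>v x) \<bullet> (M *\<^sub>v (C *\<^sub>v x))"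
    by (rule comm_scalar_prod[of _ r]) (use M C x in auto)
  finally show "x \<bullet> (transpose_mat C * M * C *\<^sub>v x) = (C *\<^sub>v x) \<bullet> (M *\<^sub>v (C *\<^sub>v x))" .
qed

section \<open>Real matrices acting on complex vectors\<close>

abbreviation cmat :: "real mat \<Rightarrow> complex mat" where
  "cmat \<equiv> map_mat complex_of_real"

lemma Re_cmat_mult_vec:
  assumes "A \<in> carrier_mat r c" "y \<in> carrier_vec c"
  shows "map_vec Re (cmat A *\<^sub>v y) = A *\<^sub>v map_vec Re y"
  using assms by (intro eq_vecI) (auto simp: scalar_prod_def)

lemma Im_cmat_mult_vec:
  assumes "A \<in> carrier_mat r c" "y \<in> carrier_vec c"
  shows "map_vec Im (cmat A *\<^sub>v y) = A *\<^sub>v map_vec Im y"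
  using assms by (intro eq_vecI) (auto simp: scalar_prod_def)

lemma cnorm2_sq: "(cnorm2 y)\<^sup>2 = map_vec Re y \<bullet> map_vec Re y + map_vec Im y \<bullet> map_vec Im y"
  by (simp add: cnorm2_def sum_nonneg scalar_prod_self_sum cmod_power2 sum.distrib)

lemma complex_vec_eq_0_iff:
  assumes "y \<in> carrier_vec n"
  shows "y = 0\<^sub>v n \<longleftrightarrow> map_vec Re y = 0\<^sub>v n \<and> map_vec Im y = 0\<^sub>v n"
  using assms by (auto simp: vec_eq_iff complex_eq_iff)

lemma cnorm2_pos:
  assumes y: "y \<in> carrier_vec n" "y \<noteq> 0\<^sub>v n"
  shows "0 < cnorm2 y"
proof -
  have "0 < map_vec Re y \<bullet> map_vec Re y \<or> 0 < map_vec Im y \<bullet> map_vec Im y"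
    using y scalar_prod_self_pos[of "map_vec Re y" n] scalar_prod_self_pos[of "map_vec Im y" n]
    by (auto simp: complex_vec_eq_0_iff)
  hence "0 < (cnorm2 y)\<^sup>2" unfolding cnorm2_sq
    using scalar_prod_self_nonneg[of "map_vec Re y"] scalar_prod_self_nonneg[of "map_vec Im y"] by linarith
  moreover have "0 \<le> cnorm2 y" by (simp add: cnorm2_def sum_nonneg)
  ultimately show ?thesis by (simp add: zero_less_power2)
qed

text \<open>For symmetric \<open>M\<close> this is y* M y. Written through real and imaginary parts
  it is real by construction, and real estimates can be applied to each summand.\<close>

definition hform :: "real mat \<Rightarrow> complex vec \<Rightarrow> real" where
  "hform M y = map_vec Re y \<bullet> (M *\<^sub>v map_vec Re y) + map_vec Im y \<bullet> (M *\<^sub>v map_vec Im y)"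

lemma Re_conjugate_scalar_prod:
  assumes "y \<in> carrier_vec n" "w \<in> carrier_vec n"
  shows "Re (conjugate y \<bullet> w) = map_vec Re y \<bullet> map_vec Re w + map_vec Im y \<bullet> map_vec Im w"
  using assms by (simp add: scalar_prod_def sum.distrib)

lemma Im_conjugate_scalar_prod:
  assumes "y \<in> carrier_vec n" "w \<in> carrier_vec n"
  shows "Im (conjugate y \<bullet> w) = map_vec Re y \<bullet> map_vec Im w - map_vec Im y \<bullet> map_vec Re w"
  using assms by (simp add: scalar_prod_def sum_subtractf sum.distrib sum_negf)

text \<open>The imaginary part of y* M y is Re y . M Im y - Im y . M Re y, which vanishes by
  symmetry.\<close>

lemma hform_eq:
  assumes M: "M \<in> carrier_mat n n" "transpose_mat M = M" and y: "y \<in> carrier_vec n"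
  shows "conjugate y \<bullet> (cmat M *\<^sub>v y) = complex_of_real (hform M y)"
proof -
  let ?w = "cmat M *\<^sub>v y"
  have w: "?w \<in> carrier_vec n" using M y by simp
  have "Re (conjugate y \<bullet> ?w) = map_vec Re y \<bullet> map_vec Re ?w + map_vec Im y \<bullet> map_vec Im ?w"
    by (rule Re_conjugate_scalar_prod[OF y w])
  also have "\<dots> = hform M y"
    using M y by (simp add: hform_def Re_cmat_mult_vec Im_cmat_mult_vec)
  finally have re: "Re (conjugate y \<bullet> ?w) = hform M y" .
  have "Im (conjugate y \<bullet> ?w) = map_vec Re y \<bullet> map_vec Im ?w - map_vec Im y \<bullet> map_vec Re ?w"
    by (rule Im_conjugate_scalar_prod[OF y w])
  also have "\<dots> = 0"
    using M y symmetric_scalar_prod[OF M, of "map_vec Re y" "map_vec Im y"]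
    by (simp add: Re_cmat_mult_vec Im_cmat_mult_vec)
  finally show ?thesis using re by (simp add: complex_eq_iff)
qed

lemma hform_rayleigh:
  assumes M: "M \<in> carrier_mat n n" "transpose_mat M = M" "0 < n" and y: "y \<in> carrier_vec n"
  shows "lambda_min M * (cnorm2 y)\<^sup>2 \<le> hform M y" "hform M y \<le> lambda_max M * (cnorm2 y)\<^sup>2"
  unfolding hform_def cnorm2_sq distrib_left
  by (intro add_mono lambda_min_le_rayleigh[OF M] rayleigh_le_lambda_max[OF M]; use y in simp)+

lemma hform_mat_inv_rayleigh:
  assumes M: "spd n M" "0 < n" and y: "y \<in> carrier_vec n"
  shows "hform (mat_inv M) y \<le> (cnorm2 y)\<^sup>2 / lambda_min M"
    and "(cnorm2 y)\<^sup>2 / lambda_max M \<le> hform (mat_inv M) y"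
  unfolding hform_def cnorm2_sq add_divide_distrib
  by (intro add_mono mat_inv_rayleigh_bounds[OF M]; use y in simp)+

lemma hform_congruence:
  assumes "M \<in> carrier_mat r r" "transpose_mat M = M" "C \<in> carrier_mat r n" "y \<in> carrier_vec n"
  shows "hform (transpose_mat C * M * C) y = hform M (cmat C *\<^sub>v y)"
  using assms congruence_form(2)[OF assms(1-3)]
  by (simp add: hform_def Re_cmat_mult_vec Im_cmat_mult_vec)

lemma spd_scalar_prod_nonneg:
  assumes "spd n M" "x \<in> carrier_vec n"
  shows "0 \<le> x \<bullet> (M *\<^sub>v x)"
proof (cases "x = 0\<^sub>v n")
  case True
  have "M *\<^sub>v x \<in> carrier_vec n" using assms by (auto simp: spd_def)
  thus ?thesis unfolding True by simp
next
  case False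
  thus ?thesis using assms unfolding spd_def by (metis less_imp_le)
qed

lemma hform_nonneg: "spd n M \<Longrightarrow> y \<in> carrier_vec n \<Longrightarrow> 0 \<le> hform M y"
  unfolding hform_def by (intro add_nonneg_nonneg spd_scalar_prod_nonneg[of n]) auto

lemma cmat_add_mult_vec:
  assumes "A \<in> carrier_mat r c" "C \<in> carrier_mat r c" "y \<in> carrier_vec c"
  shows "cmat (A + C) *\<^sub>v y = cmat A *\<^sub>v y + cmat C *\<^sub>v y"
proof -
  have "cmat (A + C) = cmat A + cmat C" using assms by (intro eq_matI) auto
  thus ?thesis using assms by (simp add: add_mult_distrib_mat_vec[of _ r c])
qed

lemma cmat_smult_mult_vec:
  assumes "A \<in> carrier_mat r c" "y \<in> carrier_vec c"
  shows "cmat (k \<cdot>\<^sub>m A) *\<^sub>v y = complex_of_real k \<cdot>\<^sub>v (cmat A *\<^sub>v y)"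
proof -
  have "cmat (k \<cdot>\<^sub>m A) = complex_of_real k \<cdot>\<^sub>m cmat A" using assms by (intro eq_matI) auto
  thus ?thesis using assms by (simp add: smult_mat_mult_vec[of _ r c])
qed

lemma cmat_mult_mult_vec:
  assumes "A \<in> carrier_mat r s" "C \<in> carrier_mat s c" "y \<in> carrier_vec c"
  shows "cmat (A * C) *\<^sub>v y = cmat A *\<^sub>v (cmat C *\<^sub>v y)"
  using assms by (simp add: of_real_hom.mat_hom_mult[of A r s C c] assoc_mult_mat_vec[of _ r s _ c])

lemma cmat_zero_mult_vec: "v \<in> carrier_vec c \<Longrightarrow> cmat (0\<^sub>m r c) *\<^sub>v v = 0\<^sub>v r"
  by (intro eq_vecI) (auto simp: scalar_prod_def)

lemma cmat_uminus_mult_vec: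
  assumes "A \<in> carrier_mat r c" "v \<in> carrier_vec c"
  shows "cmat (- A) *\<^sub>v v = - (cmat A *\<^sub>v v)"
proof -
  have "cmat (- A) = - cmat A" by (intro eq_matI) auto
  thus ?thesis using assms by simp
qed

lemma cmat_mult_zero_vec: "A \<in> carrier_mat r c \<Longrightarrow> cmat A *\<^sub>v 0\<^sub>v c = 0\<^sub>v r"
  by (intro eq_vecI) auto

lemma cmat_inverse_vec:
  assumes "A \<in> carrier_mat n n" "C \<in> carrier_mat n n" "A * C = 1\<^sub>m n" "y \<in> carrier_vec n"
  shows "cmat A *\<^sub>v (cmat C *\<^sub>v y) = y"
  using cmat_mult_mult_vec[OF assms(1,2,4)] assms(3,4) by (simp add: of_real_hom.mat_hom_one)

section \<open>Block matrices acting on stacked vectors\<close>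

lemma append_vec_dim_0: "dim_vec w = 0 \<Longrightarrow> v @\<^sub>v w = v"
  by (intro eq_vecI) auto

lemma hcat_carrier: "X \<in> carrier_mat r c1 \<Longrightarrow> Y \<in> carrier_mat r c2 \<Longrightarrow> hcat X Y \<in> carrier_mat r (c1 + c2)"
  unfolding hcat_def by (metis add.right_neutral carrier_matD(2) four_block_carrier_mat zero_carrier_mat)

text \<open>\<open>hcat\<close> is a four-block matrix whose lower blocks have zero rows, so the
  block product carries an empty lower vector that is dropped at the end.\<close>

lemma cmat_hcat_mult_vec:
  assumes X: "X \<in> carrier_mat r c1" and Y: "Y \<in> carrier_mat r c2"
    and x: "x \<in> carrier_vec c1" and y: "y \<in> carrier_vec c2"
  shows "cmat (hcat X Y) *\<^sub>v (x @\<^sub>v y) = cmat X *\<^sub>v x + cmat Y *\<^sub>v y"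
proof -
  have "cmat (hcat X Y) = four_block_mat (cmat X) (cmat Y) (cmat (0\<^sub>m 0 c1)) (cmat (0\<^sub>m 0 c2))"
    using X Y unfolding hcat_def by (subst map_four_block_mat[of _ r c1 _ c2 _ 0]) auto
  also have "\<dots> *\<^sub>v (x @\<^sub>v y) = (cmat X *\<^sub>v x + cmat Y *\<^sub>v y) @\<^sub>v
      (cmat (0\<^sub>m 0 c1) *\<^sub>v x + cmat (0\<^sub>m 0 c2) *\<^sub>v y)"
    using X Y x y by (intro four_block_mat_mult_vec[of _ r c1 _ c2 _ 0]) auto
  also have "\<dots> = cmat X *\<^sub>v x + cmat Y *\<^sub>v y" by (rule append_vec_dim_0) simp
  finally show ?thesis .
qed

lemma cmat_append_rows_mult_vec:
  assumes X: "X \<in> carrier_mat r1 c" and Y: "Y \<in> carrier_mat r2 c" and v: "v \<in> carrier_vec c"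
  shows "cmat (X @\<^sub>r Y) *\<^sub>v v = (cmat X *\<^sub>v v) @\<^sub>v (cmat Y *\<^sub>v v)"
proof -
  have "cmat (X @\<^sub>r Y) = cmat X @\<^sub>r cmat Y"
    using X Y unfolding append_rows_def by (intro eq_matI) auto
  thus ?thesis using mat_mult_append[of "cmat X" r1 c "cmat Y" r2 v] assms by simp
qed

lemma
  assumes "M11 \<in> carrier_mat r1 c1" "M12 \<in> carrier_mat r1 c2" "M13 \<in> carrier_mat r1 c3"
    "M21 \<in> carrier_mat r2 c1" "M22 \<in> carrier_mat r2 c2" "M23 \<in> carrier_mat r2 c3"
    "M31 \<in> carrier_mat r3 c1" "M32 \<in> carrier_mat r3 c2" "M33 \<in> carrier_mat r3 c3"
  shows block3_carrier:
      "block3 M11 M12 M13 M21 M22 M23 M31 M32 M33 \<in> carrier_mat (r1 + (r2 + r3)) (c1 + (c2 + c3))"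
    and cmat_block3_mult_vec:
      "x \<in> carrier_vec c1 \<Longrightarrow> y \<in> carrier_vec c2 \<Longrightarrow> z \<in> carrier_vec c3 \<Longrightarrow>
      cmat (block3 M11 M12 M13 M21 M22 M23 M31 M32 M33) *\<^sub>v (x @\<^sub>v y @\<^sub>v z) =
      (cmat M11 *\<^sub>v x + (cmat M12 *\<^sub>v y + cmat M13 *\<^sub>v z)) @\<^sub>v
      (cmat M21 *\<^sub>v x + (cmat M22 *\<^sub>v y + cmat M23 *\<^sub>v z)) @\<^sub>v
      (cmat M31 *\<^sub>v x + (cmat M32 *\<^sub>v y + cmat M33 *\<^sub>v z))"
proof -
  have rows: "hcat M11 (hcat M12 M13) \<in> carrier_mat r1 (c1 + (c2 + c3))"
    "hcat M21 (hcat M22 M23) \<in> carrier_mat r2 (c1 + (c2 + c3))"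
    "hcat M31 (hcat M32 M33) \<in> carrier_mat r3 (c1 + (c2 + c3))"
    by (intro hcat_carrier assms)+
  note lower = carrier_append_rows[OF rows(2,3)]
  show "block3 M11 M12 M13 M21 M22 M23 M31 M32 M33 \<in> carrier_mat (r1 + (r2 + r3)) (c1 + (c2 + c3))"
    unfolding block3_def by (intro carrier_append_rows rows)
  assume x: "x \<in> carrier_vec c1" and y: "y \<in> carrier_vec c2" and z: "z \<in> carrier_vec c3"
  have yz: "y @\<^sub>v z \<in> carrier_vec (c2 + c3)" using y z by simp
  have xyz: "x @\<^sub>v y @\<^sub>v z \<in> carrier_vec (c1 + (c2 + c3))" using x yz by (rule append_carrier_vec)
  show "cmat (block3 M11 M12 M13 M21 M22 M23 M31 M32 M33) *\<^sub>v (x @\<^sub>v y @\<^sub>v z) =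
      (cmat M11 *\<^sub>v x + (cmat M12 *\<^sub>v y + cmat M13 *\<^sub>v z)) @\<^sub>v
      (cmat M21 *\<^sub>v x + (cmat M22 *\<^sub>v y + cmat M23 *\<^sub>v z)) @\<^sub>v
      (cmat M31 *\<^sub>v x + (cmat M32 *\<^sub>v y + cmat M33 *\<^sub>v z))"
    unfolding block3_def cmat_append_rows_mult_vec[OF rows(1) lower xyz]
      cmat_append_rows_mult_vec[OF rows(2,3) xyz]
      cmat_hcat_mult_vec[OF assms(1) hcat_carrier[OF assms(2,3)] x yz]
      cmat_hcat_mult_vec[OF assms(4) hcat_carrier[OF assms(5,6)] x yz]
      cmat_hcat_mult_vec[OF assms(7) hcat_carrier[OF assms(8,9)] x yz]
      cmat_hcat_mult_vec[OF assms(2,3) y z] cmat_hcat_mult_vec[OF assms(5,6) y z]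
      cmat_hcat_mult_vec[OF assms(8,9) y z] ..
qed

section \<open>Full row rank and the constants of \<open>B\<close>\<close>

text \<open>A maximal independent set of columns has as many elements as the rank, here
  \<open>p\<close>, so it is a basis of the whole space, and its span lies in the column
  space.\<close>

lemma full_rank_surj:
  fixes B :: "real mat"
  assumes B: "B \<in> carrier_mat p m" and rank: "vec_space.rank p B = p" and z: "z \<in> carrier_vec p"
  obtains x where "x \<in> carrier_vec m" "B *\<^sub>v x = z"
proof -
  interpret vec_space "TYPE(real)" p .
  have cols: "set (cols B) \<subseteq> carrier_vec p" using B cols_dim by blast
  have "lin_indpt {}" by (rule finite_lin_indpt2) auto
  hence "\<exists>S. finite S \<and> maximal S (\<lambda>T. T \<subseteq> set (cols B) \<and> lin_indpt T) \<and> {} \<subseteq> S"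
    by (intro maximal_exists_superset[of "set (cols B)"]) auto
  then obtain S where S: "maximal S (\<lambda>T. T \<subseteq> set (cols B) \<and> lin_indpt T)" "finite S"
    by blast
  have S': "S \<subseteq> set (cols B)" "lin_indpt S" using S(1) by (auto simp: maximal_def)
  have "card S = p" using rank_card_indpt[OF B S(1)] rank by simp
  hence "basis S"
    using S(2) S'(2) subset_trans[OF S'(1) cols] dim_li_is_basis[OF fin_dim] dim_is_n by simp
  hence "span S = carrier_vec p" unfolding basis_def by simp
  hence "z \<in> col_space B"
    using z span_is_monotone[OF S'(1)] unfolding col_space_def by blast
  hence "\<exists>x\<in>carrier_vec (dim_col B). B *\<^sub>v x = z" unfolding col_space_eq[OF B] by blast
  thus ?thesis using that B by blast
qed

text \<open>Writing z = B x gives z . z = (B^T z) . x = 0.\<close>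

lemma full_rank_transpose_kernel:
  fixes B :: "real mat"
  assumes B: "B \<in> carrier_mat p m" and rank: "vec_space.rank p B = p" and z: "z \<in> carrier_vec p"
    and 0: "transpose_mat B *\<^sub>v z = 0\<^sub>v m"
  shows "z = 0\<^sub>v p"
proof -
  obtain x where x: "x \<in> carrier_vec m" "B *\<^sub>v x = z" using full_rank_surj[OF B rank z] .
  have "z \<bullet> z = 0" using transpose_vec_mult_scalar[OF B x(1) z] 0 x by simp
  thus ?thesis using scalar_prod_self_pos[OF z] by fastforce
qed

lemma full_rank_cmat_transpose_kernel:
  assumes B: "B \<in> carrier_mat p m" and rank: "vec_space.rank p B = p" and z: "z \<in> carrier_vec p"
    and 0: "cmat (transpose_mat B) *\<^sub>v z = 0\<^sub>v m"
  shows "z = 0\<^sub>v p"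
proof -
  have Bt: "transpose_mat B \<in> carrier_mat m p" using B by simp
  have "map_vec Re (0\<^sub>v m) = 0\<^sub>v m" "map_vec Im (0\<^sub>v m) = 0\<^sub>v m" by (auto intro!: eq_vecI)
  hence "transpose_mat B *\<^sub>v map_vec Re z = 0\<^sub>v m" "transpose_mat B *\<^sub>v map_vec Im z = 0\<^sub>v m"
    using 0 Re_cmat_mult_vec[OF Bt z] Im_cmat_mult_vec[OF Bt z] by simp_all
  hence "map_vec Re z = 0\<^sub>v p" "map_vec Im z = 0\<^sub>v p"
    using z by (auto intro!: full_rank_transpose_kernel[OF B rank])
  thus ?thesis using complex_vec_eq_0_iff[OF z] by simp
qed

section \<open>Estimates of B y by the spectral norm and by xi\<close>

lemma rnorm2_sq: "(rnorm2 x)\<^sup>2 = x \<bullet> x"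
  by (simp add: rnorm2_def scalar_prod_self_sum sum_nonneg)

lemma rnorm2_nonneg: "0 \<le> rnorm2 x"
  by (simp add: rnorm2_def sum_nonneg)

text \<open>The real supremum bounds the elements of its set only once the set is known to be
  bounded above; the constant of \<open>mult_mat_vec_bound\<close> provides this.\<close>

lemma spec_norm_upper:
  assumes B: "B \<in> carrier_mat p m" and x: "x \<in> carrier_vec m" and nx: "rnorm2 x = 1"
  shows "rnorm2 (B *\<^sub>v x) \<le> spec_norm B"
proof -
  obtain C where C: "0 < C" "\<And>x. x \<in> carrier_vec m \<Longrightarrow> (B *\<^sub>v x) \<bullet> (B *\<^sub>v x) \<le> C * (x \<bullet> x)"
    using mult_mat_vec_bound[OF B] by blast
  have "rnorm2 (B *\<^sub>v u) \<le> sqrt C" if "u \<in> carrier_vec m" "rnorm2 u = 1" for u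
    using C(2)[OF that(1)] that(2) rnorm2_sq[of u] rnorm2_sq[of "B *\<^sub>v u"] by (intro real_le_rsqrt) simp
  hence "bdd_above {rnorm2 (B *\<^sub>v x) | x. x \<in> carrier_vec (dim_col B) \<and> rnorm2 x = 1}"
    using B by (intro bdd_aboveI[of _ "sqrt C"]) auto
  thus ?thesis unfolding spec_norm_def using x nx B by (intro cSup_upper) auto
qed

lemma spec_norm_bound:
  assumes B: "B \<in> carrier_mat p m" and x: "x \<in> carrier_vec m"
  shows "(B *\<^sub>v x) \<bullet> (B *\<^sub>v x) \<le> (spec_norm B)\<^sup>2 * (x \<bullet> x)"
proof (cases "x = 0\<^sub>v m")
  case True
  hence "B *\<^sub>v x = 0\<^sub>v p" using B by (intro eq_vecI) auto
  thus ?thesis using True by simp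
next
  case False
  define s where "s = rnorm2 x"
  have xx: "0 < x \<bullet> x" by (rule scalar_prod_self_pos[OF x False])
  hence "0 < s\<^sup>2" unfolding s_def rnorm2_sq .
  hence s: "0 < s" using rnorm2_nonneg[of x] by (auto simp: s_def)
  let ?u = "(1 / s) \<cdot>\<^sub>v x"
  have u: "?u \<in> carrier_vec m" using x by simp
  have "(rnorm2 ?u)\<^sup>2 = 1\<^sup>2"
    unfolding rnorm2_sq using x s xx rnorm2_sq[of x]
    by (simp add: s_def power2_eq_square field_simps)
  hence "rnorm2 ?u = 1" by (rule power2_eq_imp_eq) (simp_all add: rnorm2_nonneg)
  hence "rnorm2 (B *\<^sub>v ?u) \<le> spec_norm B" by (rule spec_norm_upper[OF B u])
  hence "(rnorm2 (B *\<^sub>v ?u))\<^sup>2 \<le> (spec_norm B)\<^sup>2" by (rule power_mono) (rule rnorm2_nonneg)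
  moreover have "(rnorm2 (B *\<^sub>v ?u))\<^sup>2 = (B *\<^sub>v x) \<bullet> (B *\<^sub>v x) / (x \<bullet> x)"
    unfolding rnorm2_sq mult_mat_vec[OF B x] using B x s rnorm2_sq[of x] scalar_prod_self_pos[OF x False]
    by (simp add: scalar_prod_smult_distrib[of _ p] s_def power2_eq_square)
  ultimately show ?thesis using scalar_prod_self_pos[OF x False] by (simp add: pos_divide_le_eq)
qed

lemma cnorm2_spec_norm_bound:
  assumes B: "B \<in> carrier_mat p m" and y: "y \<in> carrier_vec m"
  shows "(cnorm2 (cmat B *\<^sub>v y))\<^sup>2 \<le> (spec_norm B)\<^sup>2 * (cnorm2 y)\<^sup>2"
  unfolding cnorm2_sq Re_cmat_mult_vec[OF B y] Im_cmat_mult_vec[OF B y] distrib_left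
  by (intro add_mono spec_norm_bound[OF B]; use y in simp)

lemma cnorm2_smult: "cnorm2 (a \<cdot>\<^sub>v y) = cmod a * cnorm2 y"
  by (simp add: cnorm2_def norm_mult power_mult_distrib sum_distrib_left[symmetric] real_sqrt_mult)

lemma cnorm2_nonneg: "0 \<le> cnorm2 y"
  by (simp add: cnorm2_def sum_nonneg)

text \<open>Since B y is nonzero, y / |y| is an admissible vector for the infimum. This also makes
  the set nonempty, which gives \<open>0 \<le> xi_B B\<close>; that sign is what permits squaring
  the estimate.\<close>

lemma xi_B_bound:
  assumes B: "B \<in> carrier_mat p m" and y: "y \<in> carrier_vec m" and ne: "cmat B *\<^sub>v y \<noteq> 0\<^sub>v p"
  shows "0 \<le> xi_B B" "(xi_B B)\<^sup>2 * (cnorm2 y)\<^sup>2 \<le> (cnorm2 (cmat B *\<^sub>v y))\<^sup>2"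
proof -
  let ?X = "{cnorm2 (cmat B *\<^sub>v y) | y. y \<in> carrier_vec (dim_col B) \<and>
    y \<notin> mat_kernel (cmat B) \<and> (\<Sum>i<dim_vec y. cnj (y $ i) * y $ i) = 1}"
  have cB: "cmat B \<in> carrier_mat p m" using B by simp
  have "y \<noteq> 0\<^sub>v m" using ne B by (auto intro!: eq_vecI)
  hence s: "0 < cnorm2 y" using cnorm2_pos[OF y] by simp
  let ?a = "complex_of_real (1 / cnorm2 y)"
  let ?u = "?a \<cdot>\<^sub>v y"
  have u: "?u \<in> carrier_vec m" using y by simp
  have Bu: "cmat B *\<^sub>v ?u = ?a \<cdot>\<^sub>v (cmat B *\<^sub>v y)" by (rule mult_mat_vec[OF cB y])
  have "cmat B *\<^sub>v ?u \<noteq> 0\<^sub>v p"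
  proof
    assume "cmat B *\<^sub>v ?u = 0\<^sub>v p"
    hence "complex_of_real (cnorm2 y) \<cdot>\<^sub>v (?a \<cdot>\<^sub>v (cmat B *\<^sub>v y)) = complex_of_real (cnorm2 y) \<cdot>\<^sub>v 0\<^sub>v p"
      using Bu by simp
    moreover have "complex_of_real (cnorm2 y) \<cdot>\<^sub>v 0\<^sub>v p = 0\<^sub>v p" by (intro eq_vecI) auto
    ultimately show False using ne s by (simp add: smult_smult_assoc)
  qed
  hence "?u \<notin> mat_kernel (cmat B)" using mat_kernelD[OF cB] by blast
  moreover have "(\<Sum>i<dim_vec ?u. cnj (?u $ i) * ?u $ i) = 1"
  proof -
    have "(\<Sum>i<dim_vec ?u. cnj (?u $ i) * ?u $ i) = complex_of_real (\<Sum>i<dim_vec ?u. (cmod (?u $ i))\<^sup>2)"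
      unfolding of_real_sum
      by (rule sum.cong) (simp_all only: complex_norm_square mult.commute)
    also have "(\<Sum>i<dim_vec ?u. (cmod (?u $ i))\<^sup>2) = (cnorm2 ?u)\<^sup>2"
      by (simp add: cnorm2_def sum_nonneg)
    also have "\<dots> = 1" using s by (simp add: cnorm2_smult norm_divide)
    finally show ?thesis by simp
  qed
  ultimately have mem: "cnorm2 (cmat B *\<^sub>v ?u) \<in> ?X" using u B by auto
  have "xi_B B \<le> cnorm2 (cmat B *\<^sub>v ?u)" unfolding xi_B_def
    by (rule cInf_lower[OF mem]) (auto intro!: bdd_belowI[of _ 0] cnorm2_nonneg)
  also have "\<dots> = cnorm2 (cmat B *\<^sub>v y) / cnorm2 y" unfolding Bu using s by (simp add: cnorm2_smult norm_divide)
  finally have le: "xi_B B * cnorm2 y \<le> cnorm2 (cmat B *\<^sub>v y)" using s by (simp add: pos_le_divide_eq)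
  show nonneg: "0 \<le> xi_B B" unfolding xi_B_def
    by (rule cInf_greatest) (use mem cnorm2_nonneg in auto)
  show "(xi_B B)\<^sup>2 * (cnorm2 y)\<^sup>2 \<le> (cnorm2 (cmat B *\<^sub>v y))\<^sup>2"
    using power_mono[OF le, of 2] nonneg s by (simp add: power_mult_distrib)
qed

text \<open>Both constants are compared at one vector outside the kernel, a preimage of a unit
  vector. The result shows that the lower bound of the theorem never exceeds 1.\<close>

lemma xi_B_sq_le_spec_norm_sq:
  assumes B: "B \<in> carrier_mat p m" and rank: "vec_space.rank p B = p" and p: "0 < p"
  shows "(xi_B B)\<^sup>2 \<le> (spec_norm B)\<^sup>2"
proof -
  obtain x where x: "x \<in> carrier_vec m" "B *\<^sub>v x = unit_vec p 0"
    using full_rank_surj[OF B rank unit_vec_carrier] .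
  let ?y = "map_vec complex_of_real x"
  have y: "?y \<in> carrier_vec m" using x by simp
  have "cmat B *\<^sub>v ?y = map_vec complex_of_real (unit_vec p 0)"
    using of_real_hom.mult_mat_vec_hom[OF B x(1), where 'a = complex] unfolding x(2) by (rule sym)
  hence ne: "cmat B *\<^sub>v ?y \<noteq> 0\<^sub>v p" using p unit_vec_nonzero[of 0 p] by auto
  have "?y \<noteq> 0\<^sub>v m"
  proof
    assume "?y = 0\<^sub>v m"
    moreover have "cmat B *\<^sub>v 0\<^sub>v m = 0\<^sub>v p" using B by (intro eq_vecI) auto
    ultimately show False using ne by metis
  qed
  hence "0 < (cnorm2 ?y)\<^sup>2" using cnorm2_pos[OF y] by simp
  moreover have "(xi_B B)\<^sup>2 * (cnorm2 ?y)\<^sup>2 \<le> (spec_norm B)\<^sup>2 * (cnorm2 ?y)\<^sup>2"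
    using xi_B_bound(2)[OF B y ne] cnorm2_spec_norm_bound[OF B y] by simp
  ultimately show ?thesis by simp
qed

section \<open>The eigenvalue problem\<close>

text \<open>The last claim serves vectors y in the kernel of B: there c vanishes, and the general
  estimate yields only 0 as a lower bound for Re l.\<close>

lemma quadratic_root_bounds:
  fixes a c k :: real and l :: complex
  assumes a: "0 < a" and k: "0 \<le> k" and c: "0 \<le> c" and l: "l \<noteq> 0"
    and eq: "l\<^sup>2 * of_real (a + c) - l * of_real (k + a + 2 * c) + of_real c = 0"
  shows "Im l = 0" "0 < Re l" "Re l < 2 + k / a" "c \<le> Re l * (k + a + 2 * c)"
    "c = 0 \<Longrightarrow> 1 \<le> Re l"
proof -
  define r s where "r = Re l" and "s = Im l"
  have re: "(r\<^sup>2 - s\<^sup>2) * (a + c) - r * (k + a + 2 * c) + c = 0"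
    using arg_cong[OF eq, of Re] by (simp add: r_def s_def power2_eq_square)
  have im: "2 * r * s * (a + c) - s * (k + a + 2 * c) = 0"
    using arg_cong[OF eq, of Im] by (simp add: r_def s_def power2_eq_square algebra_simps)
  \<comment> \<open>If l were not real, its conjugate would be the other root, so 2 Re l = (k + a +
    2 c) / (a + c) and |l|^2 = c / (a + c). Then (Re l)^2 <= |l|^2 gives (k + a + 2 c)^2 <= 4 (a +
    c) c, whereas the left side is at least (a + 2 c)^2 = a^2 + 4 (a + c) c.\<close>
  have s: "s = 0"
  proof (rule ccontr)
    assume "s \<noteq> 0"
    moreover have "s * (2 * r * (a + c) - (k + a + 2 * c)) = 0" using im by (simp add: algebra_simps)
    ultimately have sum: "2 * r * (a + c) = k + a + 2 * c" by simp
    have "(r\<^sup>2 + s\<^sup>2) * (a + c) = 2 * r * (a + c) * r - (r\<^sup>2 - s\<^sup>2) * (a + c)"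
      by (simp add: power2_eq_square algebra_simps)
    also have "\<dots> = c" unfolding sum using re by (simp add: algebra_simps)
    finally have "r\<^sup>2 * (a + c) + s\<^sup>2 * (a + c) = c" by (simp add: distrib_right)
    moreover have "0 \<le> s\<^sup>2 * (a + c)" using a c by simp
    ultimately have "r\<^sup>2 * (a + c) \<le> c" by linarith
    hence "4 * (a + c) * (r\<^sup>2 * (a + c)) \<le> 4 * (a + c) * c" using a c by (intro mult_left_mono) auto
    also have "4 * (a + c) * (r\<^sup>2 * (a + c)) = (k + a + 2 * c)\<^sup>2"
      unfolding sum[symmetric] by (simp add: power2_eq_square algebra_simps)
    finally have "(k + a + 2 * c)\<^sup>2 \<le> 4 * (a + c) * c" .
    moreover have "(a + 2 * c)\<^sup>2 \<le> (k + a + 2 * c)\<^sup>2" using a c k by (intro power_mono) auto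
    moreover have "(a + 2 * c)\<^sup>2 = a\<^sup>2 + 4 * (a + c) * c" by (simp add: power2_eq_square algebra_simps)
    moreover have "0 < a\<^sup>2" using a by simp
    ultimately show False by linarith
  qed
  thus "Im l = 0" by (simp add: s_def)
  hence r0: "r \<noteq> 0" using l by (auto simp: r_def complex_eq_iff)
  \<comment> \<open>Everything else follows from this form. The right side is positive, hence r is;
    omitting its first summand gives the lower estimate, and omitting c and dividing by r gives the
    upper one.\<close>
  have rq: "r * (k + a + 2 * c) = r\<^sup>2 * (a + c) + c" using re s by simp
  have "0 < r\<^sup>2 * (a + c)" using r0 a c by simp
  hence "0 < r * (k + a + 2 * c)" using rq c by linarith
  hence r: "0 < r" using a c k by (simp add: zero_less_mult_iff)
  thus "0 < Re l" by (simp add: r_def)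
  show "c \<le> Re l * (k + a + 2 * c)" using rq \<open>0 < r\<^sup>2 * (a + c)\<close> by (simp add: r_def)
  have "r * (r * (a + c)) \<le> r * (k + a + 2 * c)" using rq c by (simp add: power2_eq_square mult.assoc)
  hence up: "r * (a + c) \<le> k + a + 2 * c" using r by simp
  \<comment> \<open>This exceeds k + a + 2 c by a + k c / a, and a > 0 makes the bound
    strict.\<close>
  have "(2 + k / a) * (a + c) = 2 * a + 2 * c + k + k * c / a" using a by (simp add: field_simps)
  moreover have "0 \<le> k * c / a" using a k c by simp
  ultimately have "r * (a + c) < (2 + k / a) * (a + c)" using up a by linarith
  thus "Re l < 2 + k / a" using a c by (simp add: r_def)
  show "1 \<le> Re l" if "c = 0"
  proof -
    have "r * (k + a) = r * (r * a)" using rq that by (simp add: power2_eq_square)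
    hence "r * a = k + a" using r0 by simp
    hence "1 * a \<le> r * a" using k by simp
    thus ?thesis using a by (simp add: r_def)
  qed
qed

section \<open>The saddle point matrix and its preconditioner\<close>

locale saddle_point =
  fixes n m p :: nat and A11 A12 A22 B Q :: "real mat" and \<gamma> \<alpha> :: real
  assumes n: "0 < n" and m: "0 < m" and p: "0 < p"
    and A11: "spd n A11" and A22: "spd m A22" and A12: "A12 \<in> carrier_mat n m"
    and B: "B \<in> carrier_mat p m" and rank: "vec_space.rank p B = p"
    and Q: "spd p Q" and \<alpha>\<gamma>: "\<gamma> \<le> \<alpha>" and \<gamma>: "0 < \<gamma>"
begin

definition "T = transpose_mat B * mat_inv Q * B"
definition "S = A22 + \<gamma> \<cdot>\<^sub>m T"
definition "K = transpose_mat A12 * mat_inv A11 * A12"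
definition "Abar = block3 A11 A12 (0\<^sub>m n p) (- transpose_mat A12) S (transpose_mat B) (0\<^sub>m p n) B (0\<^sub>m p p)"
definition "P = block3 A11 A12 (0\<^sub>m n p) (0\<^sub>m m n) S ((1 - \<gamma> / \<alpha>) \<cdot>\<^sub>m transpose_mat B)
  (0\<^sub>m p n) B ((- 1 / \<alpha>) \<cdot>\<^sub>m Q)"

lemma \<alpha>: "0 < \<alpha>" using \<alpha>\<gamma> \<gamma> by simp

lemmas carriers = spdD(1)[OF A11] spdD(1)[OF A22] spdD(1)[OF Q] A12 B
  spd_mat_inv(1)[OF A11] spd_mat_inv(1)[OF Q]

lemma Bt: "transpose_mat B \<in> carrier_mat m p" and A12t: "transpose_mat A12 \<in> carrier_mat m n"
  using B A12 by auto

lemma T: "T \<in> carrier_mat m m" "transpose_mat T = T"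
proof -
  have BQ: "transpose_mat B * mat_inv Q \<in> carrier_mat m p" using Bt carriers(7) by (rule mult_carrier_mat)
  show "T \<in> carrier_mat m m" unfolding T_def using BQ B by (rule mult_carrier_mat)
  show "transpose_mat T = T" unfolding T_def
    by (rule congruence_form(1)[OF carriers(7) spdD(2)[OF spd_mat_inv(4)[OF Q]] B])
qed

lemma K: "K \<in> carrier_mat m m" "transpose_mat K = K"
proof -
  have AA: "transpose_mat A12 * mat_inv A11 \<in> carrier_mat m n"
    using A12t carriers(6) by (rule mult_carrier_mat)
  show "K \<in> carrier_mat m m" unfolding K_def using AA A12 by (rule mult_carrier_mat)
  show "transpose_mat K = K" unfolding K_def
    by (rule congruence_form(1)[OF carriers(6) spdD(2)[OF spd_mat_inv(4)[OF A11]] A12])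
qed

lemma S: "S \<in> carrier_mat m m"
  unfolding S_def using T carriers by simp

lemma hform_K: "y \<in> carrier_vec m \<Longrightarrow> hform K y = hform (mat_inv A11) (cmat A12 *\<^sub>v y)"
  unfolding K_def
  by (rule hform_congruence[OF carriers(6) spdD(2)[OF spd_mat_inv(4)[OF A11]] A12])

lemma hform_T: "y \<in> carrier_vec m \<Longrightarrow> hform T y = hform (mat_inv Q) (cmat B *\<^sub>v y)"
  unfolding T_def
  by (rule hform_congruence[OF carriers(7) spdD(2)[OF spd_mat_inv(4)[OF Q]] B])

lemma hform_K_nonneg: "y \<in> carrier_vec m \<Longrightarrow> 0 \<le> hform K y"
  unfolding hform_K by (rule hform_nonneg[OF spd_mat_inv(4)[OF A11]]) (use A12 in simp)

lemma hform_T_nonneg: "y \<in> carrier_vec m \<Longrightarrow> 0 \<le> hform T y"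
  unfolding hform_T by (rule hform_nonneg[OF spd_mat_inv(4)[OF Q]]) (use B in simp)

lemma hform_A22_pos:
  assumes y: "y \<in> carrier_vec m" "y \<noteq> 0\<^sub>v m"
  shows "0 < hform A22 y"
proof -
  have "0 < lambda_min A22 * (cnorm2 y)\<^sup>2"
    using spd_lambda_min_pos[OF A22 m] cnorm2_pos[OF y] by simp
  also have "\<dots> \<le> hform A22 y" by (rule hform_rayleigh(1)[OF spdD[OF A22] m y(1)])
  finally show ?thesis .
qed

text \<open>The vector \<open>Q\<^sup>-\<^sup>1 B y\<close>, to which the component \<open>z\<close> of an eigenvector is proportional.\<close>
definition W :: "complex vec \<Rightarrow> complex vec" where
  "W y = cmat (mat_inv Q) *\<^sub>v (cmat B *\<^sub>v y)"

lemma W_carrier: "y \<in> carrier_vec m \<Longrightarrow> W y \<in> carrier_vec p"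
  unfolding W_def using carriers by simp

lemma Bt_W:
  assumes y: "y \<in> carrier_vec m"
  shows "cmat (transpose_mat B) *\<^sub>v W y = cmat T *\<^sub>v y"
proof -
  have "cmat T *\<^sub>v y = cmat (transpose_mat B * mat_inv Q) *\<^sub>v (cmat B *\<^sub>v y)"
    unfolding T_def by (rule cmat_mult_mult_vec[OF mult_carrier_mat[OF Bt carriers(7)] B y])
  also have "\<dots> = cmat (transpose_mat B) *\<^sub>v W y"
    unfolding W_def by (rule cmat_mult_mult_vec[OF Bt carriers(7)]) (use B y in simp)
  finally show ?thesis by simp
qed

lemma S_vec: "y \<in> carrier_vec m \<Longrightarrow> cmat S *\<^sub>v y = cmat A22 *\<^sub>v y + complex_of_real \<gamma> \<cdot>\<^sub>v (cmat T *\<^sub>v y)"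
  unfolding S_def using T carriers
  by (simp add: cmat_add_mult_vec[of _ m m] cmat_smult_mult_vec[of _ m m])

text \<open>The third block row always yields a relation of this kind: s = 1, t = \<alpha> on the
  kernel of \<open>P\<close>, and s = l, t = \<alpha> (l - 1) for an eigenvector. Keeping s on the
  left avoids a division by l before l is known to be nonzero.\<close>

lemma Q_cancel:
  assumes y: "y \<in> carrier_vec m" and z: "z \<in> carrier_vec p"
    and eq: "s \<cdot>\<^sub>v (cmat Q *\<^sub>v z) = t \<cdot>\<^sub>v (cmat B *\<^sub>v y)"
  shows "s \<cdot>\<^sub>v z = t \<cdot>\<^sub>v W y"
    and "s \<cdot>\<^sub>v (cmat (transpose_mat B) *\<^sub>v z) = t \<cdot>\<^sub>v (cmat T *\<^sub>v y)"
proof -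
  have Qi: "cmat (mat_inv Q) \<in> carrier_mat p p" and Bc: "cmat B *\<^sub>v y \<in> carrier_vec p"
    and Qz: "cmat Q *\<^sub>v z \<in> carrier_vec p"
    using carriers y z by simp_all
  have "s \<cdot>\<^sub>v z = cmat (mat_inv Q) *\<^sub>v (s \<cdot>\<^sub>v (cmat Q *\<^sub>v z))"
    using cmat_inverse_vec[OF carriers(7,3) spd_mat_inv(3)[OF Q] z] mult_mat_vec[OF Qi Qz] by simp
  also have "\<dots> = t \<cdot>\<^sub>v W y" unfolding eq W_def by (rule mult_mat_vec[OF Qi Bc])
  finally show 1: "s \<cdot>\<^sub>v z = t \<cdot>\<^sub>v W y" .
  have Bt': "cmat (transpose_mat B) \<in> carrier_mat m p" using Bt by simp
  show "s \<cdot>\<^sub>v (cmat (transpose_mat B) *\<^sub>v z) = t \<cdot>\<^sub>v (cmat T *\<^sub>v y)"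
    unfolding Bt_W[OF y, symmetric] mult_mat_vec[OF Bt' z, symmetric]
      mult_mat_vec[OF Bt' W_carrier[OF y], symmetric] 1 ..
qed

section \<open>Block rows of \<open>P\<close> and \<open>Abar\<close>\<close>

lemma vec_split3:
  assumes "v \<in> carrier_vec (n + (m + p))"
  obtains x y z where "x \<in> carrier_vec n" "y \<in> carrier_vec m" "z \<in> carrier_vec p"
    "v = x @\<^sub>v y @\<^sub>v z"
  using assms vec_first_last_append[of v n "m + p"]
    vec_first_last_append[of "vec_last v (m + p)" m p] vec_first_carrier vec_last_carrier
  by metis

lemma P_carrier: "P \<in> carrier_mat (n + (m + p)) (n + (m + p))"
  unfolding P_def using S carriers Bt by (intro block3_carrier) auto

lemma Abar_carrier: "Abar \<in> carrier_mat (n + (m + p)) (n + (m + p))"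
  unfolding Abar_def using S carriers Bt A12t by (intro block3_carrier) auto

lemma P_vec:
  assumes x: "x \<in> carrier_vec n" and y: "y \<in> carrier_vec m" and z: "z \<in> carrier_vec p"
  shows "cmat P *\<^sub>v (x @\<^sub>v y @\<^sub>v z) =
    (cmat A11 *\<^sub>v x + cmat A12 *\<^sub>v y) @\<^sub>v
    (cmat S *\<^sub>v y + complex_of_real (1 - \<gamma> / \<alpha>) \<cdot>\<^sub>v (cmat (transpose_mat B) *\<^sub>v z)) @\<^sub>v
    (cmat B *\<^sub>v y + complex_of_real (- 1 / \<alpha>) \<cdot>\<^sub>v (cmat Q *\<^sub>v z))"
  unfolding P_def
  by (subst cmat_block3_mult_vec[of _ n n _ m _ p _ m _ _ _ p])
    (use S carriers Bt x y z in \<open>simp_all add: cmat_zero_mult_vec cmat_smult_mult_vec[of _ m p]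
      cmat_smult_mult_vec[of _ p p]\<close>)

lemma Abar_vec:
  assumes x: "x \<in> carrier_vec n" and y: "y \<in> carrier_vec m" and z: "z \<in> carrier_vec p"
  shows "cmat Abar *\<^sub>v (x @\<^sub>v y @\<^sub>v z) =
    (cmat A11 *\<^sub>v x + cmat A12 *\<^sub>v y) @\<^sub>v
    (- (cmat (transpose_mat A12) *\<^sub>v x) + (cmat S *\<^sub>v y + cmat (transpose_mat B) *\<^sub>v z)) @\<^sub>v
    (cmat B *\<^sub>v y)"
  unfolding Abar_def
  by (subst cmat_block3_mult_vec[of _ n n _ m _ p _ m _ _ _ p])
    (use S carriers Bt A12t x y z in \<open>simp_all add: cmat_zero_mult_vec cmat_uminus_mult_vec[of _ m n]\<close>)

lemma A11_kernel:
  assumes x: "x \<in> carrier_vec n" and "cmat A11 *\<^sub>v x = 0\<^sub>v n"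
  shows "x = 0\<^sub>v n"
proof -
  have "x = cmat (mat_inv A11) *\<^sub>v 0\<^sub>v n"
    using cmat_inverse_vec[OF carriers(6,1) spd_mat_inv(3)[OF A11] x] assms(2) by simp
  also have "\<dots> = 0\<^sub>v n" using carriers by (intro eq_vecI) auto
  finally show ?thesis .
qed

lemma W_zero: "W (0\<^sub>v m) = 0\<^sub>v p"
  unfolding W_def cmat_mult_zero_vec[OF B] by (rule cmat_mult_zero_vec[OF carriers(7)])

text \<open>The hypothesis is componentwise, so block rows can be combined by scalar algebra before
  the pairing with y* turns them into an identity between forms.\<close>

lemma hform_comb:
  assumes y: "y \<in> carrier_vec m"
    and eq: "\<And>i. i < m \<Longrightarrow> s * (cmat A22 *\<^sub>v y) $ i + t * (cmat K *\<^sub>v y) $ i + u * (cmat T *\<^sub>v y) $ i = 0"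
  shows "s * of_real (hform A22 y) + t * of_real (hform K y) + u * of_real (hform T y) = 0"
proof -
  have 1: "s * (conjugate y \<bullet> (cmat A22 *\<^sub>v y)) + t * (conjugate y \<bullet> (cmat K *\<^sub>v y))
      + u * (conjugate y \<bullet> (cmat T *\<^sub>v y)) =
    (\<Sum>i<m. cnj (y $ i) *
      (s * (cmat A22 *\<^sub>v y) $ i + t * (cmat K *\<^sub>v y) $ i + u * (cmat T *\<^sub>v y) $ i))"
    using y K(1) T(1) carriers(2)
    by (simp del: index_mult_mat_vec add: scalar_prod_def sum_distrib_left sum.distrib lessThan_atLeast0 algebra_simps)
  also have "\<dots> = 0" by (rule sum.neutral) (simp del: index_mult_mat_vec add: eq)
  finally show ?thesis
    using hform_eq[OF spdD[OF A22] y] hform_eq[OF K y] hform_eq[OF T y] by simp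
qed

text \<open>The third row gives Q z = \<alpha> B y, which turns the second into (A22 + \<alpha> T) y
  = 0. This matrix is positive definite, so y = 0, and then z and x vanish as well.\<close>

lemma P_kernel:
  assumes v: "v \<in> carrier_vec (n + (m + p))" and Pv: "cmat P *\<^sub>v v = 0\<^sub>v (n + (m + p))"
  shows "v = 0\<^sub>v (n + (m + p))"
proof -
  obtain x y z where x: "x \<in> carrier_vec n" and y: "y \<in> carrier_vec m" and z: "z \<in> carrier_vec p"
    and v_eq: "v = x @\<^sub>v y @\<^sub>v z" using vec_split3[OF v] .
  have zero: "0\<^sub>v (n + (m + p)) = 0\<^sub>v n @\<^sub>v 0\<^sub>v m @\<^sub>v (0\<^sub>v p :: complex vec)"
    by (intro eq_vecI) auto
  have cs: "cmat A11 *\<^sub>v x \<in> carrier_vec n" "cmat A12 *\<^sub>v y \<in> carrier_vec n"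
    "cmat S *\<^sub>v y \<in> carrier_vec m" "cmat (transpose_mat B) *\<^sub>v z \<in> carrier_vec m"
    "cmat B *\<^sub>v y \<in> carrier_vec p" "cmat Q *\<^sub>v z \<in> carrier_vec p"
    using carriers S Bt x y z by simp_all
  have 1: "cmat A11 *\<^sub>v x + cmat A12 *\<^sub>v y = 0\<^sub>v n"
    and 2: "cmat S *\<^sub>v y + complex_of_real (1 - \<gamma> / \<alpha>) \<cdot>\<^sub>v (cmat (transpose_mat B) *\<^sub>v z) = 0\<^sub>v m"
    and 3: "cmat B *\<^sub>v y + complex_of_real (- 1 / \<alpha>) \<cdot>\<^sub>v (cmat Q *\<^sub>v z) = 0\<^sub>v p"
    using Pv cs unfolding v_eq P_vec[OF x y z] zero
    by (simp_all add: append_vec_eq[of _ n] append_vec_eq[of _ m])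
  have "1 \<cdot>\<^sub>v (cmat Q *\<^sub>v z) = complex_of_real \<alpha> \<cdot>\<^sub>v (cmat B *\<^sub>v y)"
  proof (rule eq_vecI)
    fix i assume "i < dim_vec (complex_of_real \<alpha> \<cdot>\<^sub>v (cmat B *\<^sub>v y))"
    hence i: "i < p" using B by simp
    have "(cmat B *\<^sub>v y + complex_of_real (- 1 / \<alpha>) \<cdot>\<^sub>v (cmat Q *\<^sub>v z)) $ i = 0"
      unfolding 3 using i by simp
    hence "(cmat B *\<^sub>v y) $ i = (cmat Q *\<^sub>v z) $ i / complex_of_real \<alpha>"
      using i cs(5,6) carriers by (simp del: index_mult_mat_vec)
    thus "(1 \<cdot>\<^sub>v (cmat Q *\<^sub>v z)) $ i = (complex_of_real \<alpha> \<cdot>\<^sub>v (cmat B *\<^sub>v y)) $ i"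
      using i cs(5,6) carriers \<alpha> by (simp del: index_mult_mat_vec)
  qed (use cs carriers Bt in simp)
  note Qc = Q_cancel[OF y z this]
  have "1 * complex_of_real (hform A22 y) + 0 * complex_of_real (hform K y)
      + complex_of_real \<alpha> * complex_of_real (hform T y) = 0"
  proof (rule hform_comb[OF y])
    fix i assume i: "i < m"
    have Ty: "cmat T *\<^sub>v y \<in> carrier_vec m" "cmat A22 *\<^sub>v y \<in> carrier_vec m" using T y carriers by simp_all
    have "(1 \<cdot>\<^sub>v (cmat (transpose_mat B) *\<^sub>v z)) $ i = (complex_of_real \<alpha> \<cdot>\<^sub>v (cmat T *\<^sub>v y)) $ i"
      unfolding Qc(2) ..
    hence b: "(cmat (transpose_mat B) *\<^sub>v z) $ i = complex_of_real \<alpha> * (cmat T *\<^sub>v y) $ i"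
      using i cs carriers S T K A12t Bt Ty by (simp del: index_mult_mat_vec)
    have "(cmat S *\<^sub>v y + complex_of_real (1 - \<gamma> / \<alpha>) \<cdot>\<^sub>v (cmat (transpose_mat B) *\<^sub>v z)) $ i = 0"
      unfolding 2 using i by simp
    hence "(cmat A22 *\<^sub>v y) $ i + \<gamma> * (cmat T *\<^sub>v y) $ i
        + complex_of_real (1 - \<gamma> / \<alpha>) * (complex_of_real \<alpha> * (cmat T *\<^sub>v y) $ i) = 0"
      using i cs carriers S T Ty b unfolding S_vec[OF y]
      by (simp del: index_mult_mat_vec add: add.assoc)
    moreover have "complex_of_real (1 - \<gamma> / \<alpha>) * (complex_of_real \<alpha> * (cmat T *\<^sub>v y) $ i)
        = (complex_of_real \<alpha> - complex_of_real \<gamma>) * (cmat T *\<^sub>v y) $ i"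
      using \<alpha> by (simp del: index_mult_mat_vec add: field_simps)
    ultimately have "(cmat A22 *\<^sub>v y) $ i + \<gamma> * (cmat T *\<^sub>v y) $ i
        + (complex_of_real \<alpha> - complex_of_real \<gamma>) * (cmat T *\<^sub>v y) $ i = 0"
      by (simp only:)
    thus "1 * (cmat A22 *\<^sub>v y) $ i + 0 * (cmat K *\<^sub>v y) $ i
        + complex_of_real \<alpha> * (cmat T *\<^sub>v y) $ i = 0"
      by (simp del: index_mult_mat_vec add: algebra_simps)
  qed
  hence "complex_of_real (hform A22 y + \<alpha> * hform T y) = 0" by simp
  hence "hform A22 y + \<alpha> * hform T y = 0" by (simp only: of_real_eq_0_iff)
  moreover have "0 \<le> \<alpha> * hform T y" using hform_T_nonneg[OF y] \<alpha> by simp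
  ultimately have y0: "y = 0\<^sub>v m" using hform_A22_pos[OF y] by fastforce
  have "z = complex_of_real \<alpha> \<cdot>\<^sub>v 0\<^sub>v p" using Qc(1) unfolding y0 W_zero by simp
  hence z0: "z = 0\<^sub>v p" using z by auto
  have "cmat A11 *\<^sub>v x = 0\<^sub>v n" using 1 cs(1) unfolding y0 cmat_mult_zero_vec[OF A12] by simp
  hence "x = 0\<^sub>v n" by (rule A11_kernel[OF x])
  thus ?thesis using y0 z0 unfolding v_eq zero by simp
qed

lemma P_inverse: "mat_inv P \<in> carrier_mat (n + (m + p)) (n + (m + p))"
    "P * mat_inv P = 1\<^sub>m (n + (m + p))"
proof -
  let ?N = "n + (m + p)"
  have Pc: "cmat P \<in> carrier_mat ?N ?N" using P_carrier by simp
  \<comment> \<open>The block computation is made for complex vectors; the determinant carries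
    invertibility back to the real matrix.\<close>
  have "det (cmat P) \<noteq> 0"
    using det_0_iff_vec_prod_zero_field[OF Pc] P_kernel by auto
  hence "det P \<noteq> 0" by simp
  hence "x = 0\<^sub>v ?N" if "x \<in> carrier_vec ?N" "P *\<^sub>v x = 0\<^sub>v ?N" for x
    using det_0_iff_vec_prod_zero_field[OF P_carrier] that by auto
  thus "mat_inv P \<in> carrier_mat ?N ?N" "P * mat_inv P = 1\<^sub>m ?N"
    using trivial_kernel_inverse[OF P_carrier] unfolding mat_inv_def by (metis option.sel)+
qed

text \<open>Multiplying by \<open>P\<close> replaces the inverse by a pencil, so no block form of
  \<open>mat_inv P\<close> has to be computed.\<close>

lemma generalized_eigenvector:
  assumes ev: "eigenvalue (cmat (mat_inv P * Abar)) l"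
  obtains v where "v \<in> carrier_vec (n + (m + p))" "v \<noteq> 0\<^sub>v (n + (m + p))"
    "cmat Abar *\<^sub>v v = l \<cdot>\<^sub>v (cmat P *\<^sub>v v)"
proof -
  let ?N = "n + (m + p)"
  have c: "cmat (mat_inv P * Abar) \<in> carrier_mat ?N ?N" using P_inverse Abar_carrier by simp
  obtain v where v: "v \<in> carrier_vec ?N" "v \<noteq> 0\<^sub>v ?N" "cmat (mat_inv P * Abar) *\<^sub>v v = l \<cdot>\<^sub>v v"
    using ev eigenvalue_iff_vec[OF c] by auto
  have Av: "cmat Abar *\<^sub>v v \<in> carrier_vec ?N" and Pc: "cmat P \<in> carrier_mat ?N ?N"
    using Abar_carrier P_carrier v by simp_all
  have "cmat Abar *\<^sub>v v = cmat P *\<^sub>v (cmat (mat_inv P) *\<^sub>v (cmat Abar *\<^sub>v v))"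
    using cmat_inverse_vec[OF P_carrier P_inverse Av] by simp
  also have "\<dots> = cmat P *\<^sub>v (l \<cdot>\<^sub>v v)"
    using cmat_mult_mult_vec[OF P_inverse(1) Abar_carrier v(1)] v(3) by simp
  also have "\<dots> = l \<cdot>\<^sub>v (cmat P *\<^sub>v v)" by (rule mult_mat_vec[OF Pc v(1)])
  finally show ?thesis using that v by blast
qed

text \<open>The value 1 is excluded because the first row reads (1 - l) (A11 x + A12 y) = 0 and
  determines x from y only for l different from 1.\<close>

lemma eigenvalue_quadratic:
  assumes ev: "eigenvalue (cmat (mat_inv P * Abar)) l" and l1: "l \<noteq> 1"
  obtains y where "y \<in> carrier_vec m" "y \<noteq> 0\<^sub>v m" "l \<noteq> 0"
    "l\<^sup>2 * of_real (hform A22 y + \<alpha> * hform T y)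
      - l * of_real (hform K y + hform A22 y + 2 * (\<alpha> * hform T y)) + of_real (\<alpha> * hform T y) = 0"
proof -
  obtain v where v: "v \<in> carrier_vec (n + (m + p))" "v \<noteq> 0\<^sub>v (n + (m + p))"
    and eq: "cmat Abar *\<^sub>v v = l \<cdot>\<^sub>v (cmat P *\<^sub>v v)"
    using generalized_eigenvector[OF ev] .
  obtain x y z where x: "x \<in> carrier_vec n" and y: "y \<in> carrier_vec m" and z: "z \<in> carrier_vec p"
    and v_eq: "v = x @\<^sub>v y @\<^sub>v z" using vec_split3[OF v(1)] .
  have zero: "0\<^sub>v (n + (m + p)) = 0\<^sub>v n @\<^sub>v 0\<^sub>v m @\<^sub>v (0\<^sub>v p :: complex vec)"
    by (intro eq_vecI) auto
  have smult_append: "l \<cdot>\<^sub>v (u @\<^sub>v w) = (l \<cdot>\<^sub>v u) @\<^sub>v (l \<cdot>\<^sub>v w)" for u w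
    by (intro eq_vecI) auto
  have cs: "cmat A11 *\<^sub>v x \<in> carrier_vec n" "cmat A12 *\<^sub>v y \<in> carrier_vec n"
    "cmat S *\<^sub>v y \<in> carrier_vec m" "cmat (transpose_mat B) *\<^sub>v z \<in> carrier_vec m"
    "cmat B *\<^sub>v y \<in> carrier_vec p" "cmat Q *\<^sub>v z \<in> carrier_vec p"
    "cmat T *\<^sub>v y \<in> carrier_vec m" "cmat A22 *\<^sub>v y \<in> carrier_vec m" "cmat K *\<^sub>v y \<in> carrier_vec m"
    "cmat (transpose_mat A12) *\<^sub>v x \<in> carrier_vec m"
    using carriers S T K A12t Bt x y z by simp_all
  have 1: "cmat A11 *\<^sub>v x + cmat A12 *\<^sub>v y = l \<cdot>\<^sub>v (cmat A11 *\<^sub>v x + cmat A12 *\<^sub>v y)"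
    and 2: "- (cmat (transpose_mat A12) *\<^sub>v x) + (cmat S *\<^sub>v y + cmat (transpose_mat B) *\<^sub>v z)
      = l \<cdot>\<^sub>v (cmat S *\<^sub>v y + complex_of_real (1 - \<gamma> / \<alpha>) \<cdot>\<^sub>v (cmat (transpose_mat B) *\<^sub>v z))"
    and 3: "cmat B *\<^sub>v y = l \<cdot>\<^sub>v (cmat B *\<^sub>v y + complex_of_real (- 1 / \<alpha>) \<cdot>\<^sub>v (cmat Q *\<^sub>v z))"
    using eq cs unfolding v_eq P_vec[OF x y z] Abar_vec[OF x y z] smult_append
    by (simp_all add: append_vec_eq[of _ n] append_vec_eq[of _ m])
  have Ax: "cmat A11 *\<^sub>v x = - (cmat A12 *\<^sub>v y)"
  proof (rule eq_vecI)
    fix i assume "i < dim_vec (- (cmat A12 *\<^sub>v y))"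
    hence i: "i < n" using A12 by simp
    let ?u = "cmat A11 *\<^sub>v x + cmat A12 *\<^sub>v y"
    have "?u $ i = (l \<cdot>\<^sub>v ?u) $ i" using 1 by simp
    also have "\<dots> = l * ?u $ i" using i cs(1,2) carriers by (simp del: index_add_vec(1) index_mult_mat_vec)
    finally have "?u $ i = 0" using l1 by (metis mult_cancel_right1)
    thus "(cmat A11 *\<^sub>v x) $ i = (- (cmat A12 *\<^sub>v y)) $ i"
      using i cs carriers S T K A12t Bt by (simp del: index_mult_mat_vec add: eq_neg_iff_add_eq_0)
  qed (use cs carriers Bt in simp)
  have iA: "cmat (mat_inv A11) \<in> carrier_mat n n" using carriers by simp
  have "x = cmat (mat_inv A11) *\<^sub>v (- (cmat A12 *\<^sub>v y))"
    using cmat_inverse_vec[OF carriers(6,1) spd_mat_inv(3)[OF A11] x] Ax by simp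
  also have "\<dots> = - (cmat (mat_inv A11) *\<^sub>v (cmat A12 *\<^sub>v y))"
    by (rule mult_mat_vec_uminus[OF iA cs(2)])
  finally have x_eq: "x = - (cmat (mat_inv A11) *\<^sub>v (cmat A12 *\<^sub>v y))" .
  have "cmat (transpose_mat A12) *\<^sub>v x
      = - (cmat (transpose_mat A12) *\<^sub>v (cmat (mat_inv A11) *\<^sub>v (cmat A12 *\<^sub>v y)))"
    unfolding x_eq by (rule mult_mat_vec_uminus[of _ m n]) (use iA cs(2) A12t in simp_all)
  also have "cmat (transpose_mat A12) *\<^sub>v (cmat (mat_inv A11) *\<^sub>v (cmat A12 *\<^sub>v y)) = cmat K *\<^sub>v y"
    unfolding K_def cmat_mult_mult_vec[OF mult_carrier_mat[OF A12t carriers(6)] A12 y]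
    by (rule cmat_mult_mult_vec[OF A12t carriers(6) cs(2), symmetric])
  finally have Kx: "cmat (transpose_mat A12) *\<^sub>v x = - (cmat K *\<^sub>v y)" .
  \<comment> \<open>The third row multiplied by \<alpha> and solved for l Q z.\<close>
  have "l \<cdot>\<^sub>v (cmat Q *\<^sub>v z) = (complex_of_real \<alpha> * (l - 1)) \<cdot>\<^sub>v (cmat B *\<^sub>v y)"
  proof (rule eq_vecI)
    fix i assume "i < dim_vec ((complex_of_real \<alpha> * (l - 1)) \<cdot>\<^sub>v (cmat B *\<^sub>v y))"
    hence i: "i < p" using B by simp
    have "(cmat B *\<^sub>v y) $ i
      = (l \<cdot>\<^sub>v (cmat B *\<^sub>v y + complex_of_real (- 1 / \<alpha>) \<cdot>\<^sub>v (cmat Q *\<^sub>v z))) $ i"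
      using 3 by simp
    hence "(cmat B *\<^sub>v y) $ i
      = l * ((cmat B *\<^sub>v y) $ i - (cmat Q *\<^sub>v z) $ i / complex_of_real \<alpha>)"
      using i cs(5,6) carriers by (simp del: index_mult_mat_vec)
    hence "l * (cmat Q *\<^sub>v z) $ i = complex_of_real \<alpha> * (l - 1) * (cmat B *\<^sub>v y) $ i"
      using \<alpha> by (simp del: index_mult_mat_vec add: field_simps)
    thus "(l \<cdot>\<^sub>v (cmat Q *\<^sub>v z)) $ i = ((complex_of_real \<alpha> * (l - 1)) \<cdot>\<^sub>v (cmat B *\<^sub>v y)) $ i"
      using i cs(5,6) carriers by (simp del: index_mult_mat_vec)
  qed (use cs carriers Bt in simp)
  note Qc = Q_cancel[OF y z this]
  have row2: "(cmat K *\<^sub>v y) $ i + (cmat A22 *\<^sub>v y) $ i + \<gamma> * (cmat T *\<^sub>v y) $ i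
      + (cmat (transpose_mat B) *\<^sub>v z) $ i
    = l * ((cmat A22 *\<^sub>v y) $ i + \<gamma> * (cmat T *\<^sub>v y) $ i
      + complex_of_real (1 - \<gamma> / \<alpha>) * (cmat (transpose_mat B) *\<^sub>v z) $ i)"
    if i: "i < m" for i
  proof -
    have "(- (cmat (transpose_mat A12) *\<^sub>v x) + (cmat S *\<^sub>v y + cmat (transpose_mat B) *\<^sub>v z)) $ i
      = (l \<cdot>\<^sub>v (cmat S *\<^sub>v y + complex_of_real (1 - \<gamma> / \<alpha>) \<cdot>\<^sub>v (cmat (transpose_mat B) *\<^sub>v z))) $ i"
      using 2 by simp
    thus ?thesis unfolding Kx S_vec[OF y] using i cs carriers S T K A12t Bt
      by (simp del: index_mult_mat_vec add: add.assoc)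
  qed
  have b: "l * (cmat (transpose_mat B) *\<^sub>v z) $ i = complex_of_real \<alpha> * (l - 1) * (cmat T *\<^sub>v y) $ i"
    if i: "i < m" for i
  proof -
    have "(l \<cdot>\<^sub>v (cmat (transpose_mat B) *\<^sub>v z)) $ i
      = ((complex_of_real \<alpha> * (l - 1)) \<cdot>\<^sub>v (cmat T *\<^sub>v y)) $ i" unfolding Qc(2) ..
    thus ?thesis using i cs carriers S T K A12t Bt by (simp del: index_mult_mat_vec)
  qed
  \<comment> \<open>If y and z both vanished, the first row would give A11 x = 0 and hence x = 0,
    against the choice of v.\<close>
  have y_zero: "y \<noteq> 0\<^sub>v m" if "z = 0\<^sub>v p"
  proof
    assume y0: "y = 0\<^sub>v m"
    have "cmat A11 *\<^sub>v x = 0\<^sub>v n" unfolding Ax y0 cmat_mult_zero_vec[OF A12] by (intro eq_vecI) auto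
    hence "x = 0\<^sub>v n" by (rule A11_kernel[OF x])
    thus False using v(2) y0 that unfolding v_eq zero by simp
  qed
  \<comment> \<open>At l = 0 the third row is B y = 0, so y* B^T z = (B y)* z = 0 and the second row
    paired with y leaves y* K y + y* A22 y = 0. Hence y = 0, the second row reduces to B^T z = 0,
    and full row rank gives z = 0.\<close>
  have l0: "l \<noteq> 0"
  proof
    assume l0: "l = 0"
    let ?u = "cmat B *\<^sub>v y + complex_of_real (- 1 / \<alpha>) \<cdot>\<^sub>v (cmat Q *\<^sub>v z)"
    have "0 \<cdot>\<^sub>v u = 0\<^sub>v p" if "u \<in> carrier_vec p" for u :: "complex vec"
      using that by (intro eq_vecI) auto
    hence "0 \<cdot>\<^sub>v ?u = 0\<^sub>v p" using cs(5,6) by simp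
    hence By: "cmat B *\<^sub>v y = 0\<^sub>v p" using 3 unfolding l0 by (rule trans[rotated])
    have Ty: "cmat T *\<^sub>v y = 0\<^sub>v m"
      unfolding Bt_W[OF y, symmetric] W_def By cmat_mult_zero_vec[OF carriers(7)]
      by (rule cmat_mult_zero_vec[OF Bt])
    have sum0: "(cmat K *\<^sub>v y) $ i + (cmat A22 *\<^sub>v y) $ i + (cmat (transpose_mat B) *\<^sub>v z) $ i = 0"
      if i: "i < m" for i
      using row2[OF i] i unfolding l0 Ty by (simp del: index_mult_mat_vec)
    have "conjugate y \<bullet> (cmat (transpose_mat B) *\<^sub>v z) = 0"
    proof -
      have cB: "cmat B \<in> carrier_mat p m" and cy: "conjugate y \<in> carrier_vec m" using B y by simp_all
      \<comment> \<open>The product of vectors is bilinear, so the conjugate has to be moved through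
        \<open>B\<close> by hand; it commutes because \<open>B\<close> is real.\<close>
      have "cmat B *\<^sub>v conjugate y = conjugate (cmat B *\<^sub>v y)"
        using B y by (intro eq_vecI) (auto simp: scalar_prod_def)
      hence "cmat B *\<^sub>v conjugate y = 0\<^sub>v p" unfolding By by simp
      moreover have "(transpose_mat (cmat B) *\<^sub>v z) \<bullet> conjugate y = z \<bullet> (cmat B *\<^sub>v conjugate y)"
        by (rule transpose_vec_mult_scalar[OF cB cy z])
      moreover have "transpose_mat (cmat B) = cmat (transpose_mat B)" by (intro eq_matI) auto
      ultimately show ?thesis using z comm_scalar_prod[OF cs(4) cy] by simp
    qed
    moreover have "conjugate y \<bullet> (cmat K *\<^sub>v y) + conjugate y \<bullet> (cmat A22 *\<^sub>v y)
      + conjugate y \<bullet> (cmat (transpose_mat B) *\<^sub>v z) = 0"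
    proof -
      have cy: "conjugate y \<in> carrier_vec m" using y by simp
      have "cmat K *\<^sub>v y + cmat A22 *\<^sub>v y + cmat (transpose_mat B) *\<^sub>v z = 0\<^sub>v m"
        using sum0 cs carriers K Bt by (intro eq_vecI) (simp_all del: index_mult_mat_vec add: add.assoc)
      moreover have "conjugate y \<bullet> (cmat K *\<^sub>v y + cmat A22 *\<^sub>v y + cmat (transpose_mat B) *\<^sub>v z)
        = conjugate y \<bullet> (cmat K *\<^sub>v y) + conjugate y \<bullet> (cmat A22 *\<^sub>v y)
          + conjugate y \<bullet> (cmat (transpose_mat B) *\<^sub>v z)"
        using scalar_prod_add_distrib[OF cy add_carrier_vec[OF cs(9,8)] cs(4)]
          scalar_prod_add_distrib[OF cy cs(9,8)] by (simp only:)
      ultimately show ?thesis using cy by simp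
    qed
    ultimately have "complex_of_real (hform K y + hform A22 y) = 0"
      using hform_eq[OF spdD[OF A22] y] hform_eq[OF K y] by (simp add: algebra_simps)
    hence "hform K y + hform A22 y = 0" by (simp only: of_real_eq_0_iff)
    hence y0: "y = 0\<^sub>v m" using hform_A22_pos[OF y] hform_K_nonneg[OF y] by fastforce
    have "cmat (transpose_mat B) *\<^sub>v z = 0\<^sub>v m"
    proof (rule eq_vecI)
      fix i assume "i < dim_vec (0\<^sub>v m :: complex vec)"
      thus "(cmat (transpose_mat B) *\<^sub>v z) $ i = (0\<^sub>v m) $ i"
        using sum0[of i] unfolding y0 cmat_mult_zero_vec[OF K(1)] cmat_mult_zero_vec[OF carriers(2)]
        by (simp del: index_mult_mat_vec)
    qed (use cs carriers Bt in simp)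
    hence "z = 0\<^sub>v p" by (rule full_rank_cmat_transpose_kernel[OF B rank z])
    thus False using y_zero y0 by simp
  qed
  have yne: "y \<noteq> 0\<^sub>v m"
  proof
    assume y0: "y = 0\<^sub>v m"
    have "l \<cdot>\<^sub>v z = 0\<^sub>v p" using Qc(1) unfolding y0 W_zero by (auto simp: vec_eq_iff)
    hence "z = 0\<^sub>v p" using l0 z by (auto simp: vec_eq_iff)
    thus False using y_zero y0 by simp
  qed
  have "(l\<^sup>2 - l) * of_real (hform A22 y) + (- l) * of_real (hform K y)
      + complex_of_real \<alpha> * (l\<^sup>2 - 2 * l + 1) * of_real (hform T y) = 0"
  proof (rule hform_comb[OF y])
    fix i assume i: "i < m"
    let ?a = "(cmat A22 *\<^sub>v y) $ i" and ?k = "(cmat K *\<^sub>v y) $ i" and ?t = "(cmat T *\<^sub>v y) $ i"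
      and ?b = "(cmat (transpose_mat B) *\<^sub>v z) $ i" and ?g = "complex_of_real \<gamma>"
      and ?al = "complex_of_real \<alpha>"
    \<comment> \<open>The second row is multiplied by l so that l B^T z can be replaced by \<alpha>
      (l - 1) T y. Then \<gamma> T y has coefficient l on the left and l^2 - l (l - 1) = l on the
      right, so it drops out.\<close>
    have "l * (?k + ?a + ?g * ?t) + l * ?b
      = l * (l * (?a + ?g * ?t) + complex_of_real (1 - \<gamma> / \<alpha>) * (l * ?b))"
      using arg_cong[OF row2[OF i], of "\<lambda>u. l * u"] by (simp del: index_mult_mat_vec add: algebra_simps)
    moreover have "complex_of_real (1 - \<gamma> / \<alpha>) * (?al * (l - 1) * ?t) = (?al - ?g) * (l - 1) * ?t"
      using \<alpha> by (simp del: index_mult_mat_vec add: field_simps)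
    ultimately have "l * (?k + ?a + ?g * ?t) + ?al * (l - 1) * ?t
      = l * (l * (?a + ?g * ?t) + (?al - ?g) * (l - 1) * ?t)"
      unfolding b[OF i] by simp
    thus "(l\<^sup>2 - l) * ?a + (- l) * ?k + ?al * (l\<^sup>2 - 2 * l + 1) * ?t = 0"
      by (simp del: index_mult_mat_vec add: algebra_simps power2_eq_square)
  qed
  hence "l\<^sup>2 * of_real (hform A22 y + \<alpha> * hform T y)
      - l * of_real (hform K y + hform A22 y + 2 * (\<alpha> * hform T y)) + of_real (\<alpha> * hform T y) = 0"
    by (simp add: algebra_simps)
  thus ?thesis using that y yne l0 by blast
qed

text \<open>\<open>K\<close> may be singular or zero, so the facts on positive definite matrices do
  not apply. One nonzero vector with nonnegative form is enough to fix the sign.\<close>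

lemma lambda_max_K_nonneg: "0 \<le> lambda_max K"
proof -
  let ?e = "unit_vec m 0 :: complex vec"
  have e: "?e \<in> carrier_vec m" "?e \<noteq> 0\<^sub>v m" using m unit_vec_nonzero[of 0 m] by auto
  have "0 \<le> lambda_max K * (cnorm2 ?e)\<^sup>2"
    using hform_K_nonneg[OF e(1)] hform_rayleigh(2)[OF K m e(1)] by linarith
  thus ?thesis using cnorm2_pos[OF e] by (auto simp: zero_le_mult_iff)
qed

lemma eigenvalue_bounds:
  assumes ev: "eigenvalue (cmat (mat_inv P * Abar)) l"
  shows "Im l = 0 \<and> Re l > 0 \<and>
    (xi_B B)\<^sup>2 * \<alpha> * lambda_min Q /
      (lambda_max Q * ((lambda_max A22 + lambda_max K) * lambda_min Q + 2 * \<alpha> * (spec_norm B)\<^sup>2))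
      \<le> Re l \<and>
    Re l < 2 + lambda_max K / lambda_min A22"
proof -
  \<comment> \<open>Chosen so that \<open>D\<close> |y|^2 / lambda_min(Q) bounds k + a + 2 c from
    above; the second summand comes from 2 c.\<close>
  define D where "D = (lambda_max A22 + lambda_max K) * lambda_min Q + 2 * \<alpha> * (spec_norm B)\<^sup>2"
  define qmin qmax where "qmin = lambda_min Q" and "qmax = lambda_max Q"
  have q: "0 < qmin" "qmin \<le> qmax" "0 < qmax"
    using spd_lambda_min_pos[OF Q p] spd_lambda_min_le_max[OF Q p] by (auto simp: qmin_def qmax_def)
  have A: "0 < lambda_min A22" "0 < lambda_max A22"
    using spd_lambda_min_pos[OF A22 m] spd_lambda_min_le_max[OF A22 m] by auto
  have D: "0 < D" "2 * \<alpha> * (spec_norm B)\<^sup>2 \<le> D"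
    unfolding D_def using A lambda_max_K_nonneg q \<alpha>
    by (auto simp: qmin_def intro!: add_pos_nonneg mult_pos_pos)
  \<comment> \<open>Covers l = 1 and B y = 0, where no estimate of c through xi is at hand. The
    summand 2 \<alpha> ||B||_2^2 of \<open>D\<close> alone makes the quotient at most 1.\<close>
  have low1: "(xi_B B)\<^sup>2 * \<alpha> * qmin / (qmax * D) \<le> r" if "1 \<le> r" for r
  proof -
    have "(xi_B B)\<^sup>2 * \<alpha> * qmin \<le> (spec_norm B)\<^sup>2 * \<alpha> * qmax"
      using xi_B_sq_le_spec_norm_sq[OF B rank p] \<alpha> q by (intro mult_mono) auto
    also have "\<dots> \<le> qmax * (2 * \<alpha> * (spec_norm B)\<^sup>2)"
      using \<alpha> q by (simp add: algebra_simps)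
    also have "\<dots> \<le> qmax * D" using D(2) q by (intro mult_left_mono) auto
    finally have "(xi_B B)\<^sup>2 * \<alpha> * qmin / (qmax * D) \<le> 1" using q D by (simp add: pos_divide_le_eq)
    thus ?thesis using that by linarith
  qed
  have "Im l = 0 \<and> Re l > 0 \<and> (xi_B B)\<^sup>2 * \<alpha> * qmin / (qmax * D) \<le> Re l \<and>
    Re l < 2 + lambda_max K / lambda_min A22"
  proof (cases "l = 1")
    case True
    have "0 \<le> lambda_max K / lambda_min A22" using lambda_max_K_nonneg A by simp
    thus ?thesis using low1[of 1] True by simp
  next
    case False
    obtain y where y: "y \<in> carrier_vec m" "y \<noteq> 0\<^sub>v m" "l \<noteq> 0" and
      quad: "l\<^sup>2 * of_real (hform A22 y + \<alpha> * hform T y)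
        - l * of_real (hform K y + hform A22 y + 2 * (\<alpha> * hform T y)) + of_real (\<alpha> * hform T y) = 0"
      using eigenvalue_quadratic[OF ev False] .
    define a k c Y Z where "a = hform A22 y" and "k = hform K y" and "c = \<alpha> * hform T y"
      and "Y = (cnorm2 y)\<^sup>2" and "Z = (cnorm2 (cmat B *\<^sub>v y))\<^sup>2"
    have By: "cmat B *\<^sub>v y \<in> carrier_vec p" using B y by simp
    have a: "0 < a" and k: "0 \<le> k" and c: "0 \<le> c" and Y: "0 < Y"
      using hform_A22_pos hform_K_nonneg hform_T_nonneg y \<alpha> cnorm2_pos[OF y(1,2)]
      by (simp_all add: a_def k_def c_def Y_def)
    note bnd = quadratic_root_bounds[OF a k c y(3), of, OF quad[folded a_def k_def c_def]]
    have aY: "lambda_min A22 * Y \<le> a" "a \<le> lambda_max A22 * Y" and kY: "k \<le> lambda_max K * Y"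
      using hform_rayleigh[OF spdD[OF A22] m y(1)] hform_rayleigh[OF K m y(1)]
      by (simp_all add: a_def k_def Y_def)
    have "hform T y \<le> Z / qmin" "Z / qmax \<le> hform T y"
      using hform_mat_inv_rayleigh[OF Q p By] by (simp_all add: hform_T[OF y(1)] Z_def qmin_def qmax_def)
    hence cZ: "c \<le> \<alpha> * (Z / qmin)" "\<alpha> * (Z / qmax) \<le> c"
      unfolding c_def using \<alpha> by (intro mult_left_mono; simp)+
    have ZY: "Z \<le> (spec_norm B)\<^sup>2 * Y"
      using cnorm2_spec_norm_bound[OF B y(1)] by (simp add: Z_def Y_def)
    \<comment> \<open>Numerator and denominator are estimated separately, and the common factor
      |y|^2 cancels.\<close>
    have "k / a \<le> lambda_max K * Y / (lambda_min A22 * Y)"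
      using kY aY(1) k A Y lambda_max_K_nonneg by (intro frac_le) auto
    also have "\<dots> = lambda_max K / lambda_min A22" using Y by simp
    finally have upper: "Re l < 2 + lambda_max K / lambda_min A22" using bnd(3) by linarith
    have "(xi_B B)\<^sup>2 * \<alpha> * qmin / (qmax * D) \<le> Re l"
    \<comment> \<open>The infimum xi ranges over vectors outside Ker(B). Inside the kernel c = 0,
      and the quadratic gives Re l >= 1.\<close>
    proof (cases "cmat B *\<^sub>v y = 0\<^sub>v p")
      case True
      have "Z = 0" unfolding Z_def True by (simp add: cnorm2_def)
      hence "c = 0" using cZ c by simp
      thus ?thesis using low1 bnd(5) by simp
    next
      case False
      have xi: "(xi_B B)\<^sup>2 * Y \<le> Z" using xi_B_bound(2)[OF B y(1) False] by (simp add: Z_def Y_def)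
      have "\<alpha> * ((xi_B B)\<^sup>2 * Y / qmax) \<le> \<alpha> * (Z / qmax)"
        using xi \<alpha> q by (intro mult_left_mono divide_right_mono) auto
      also have "\<dots> \<le> c" by (rule cZ(2))
      also have "\<dots> \<le> Re l * (k + a + 2 * c)" by (rule bnd(4))
      also have "\<dots> \<le> Re l * (D * Y / qmin)"
      proof (rule mult_left_mono)
        have "c \<le> \<alpha> * ((spec_norm B)\<^sup>2 * Y / qmin)"
          using cZ(1) ZY \<alpha> q by (meson divide_right_mono less_imp_le mult_left_mono order_trans)
        hence "k + a + 2 * c \<le> lambda_max K * Y + lambda_max A22 * Y + 2 * (\<alpha> * ((spec_norm B)\<^sup>2 * Y / qmin))"
          using kY aY(2) by linarith
        also have "\<dots> = D * Y / qmin" using q unfolding D_def qmin_def by (simp add: field_simps)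
        finally show "k + a + 2 * c \<le> D * Y / qmin" .
      qed (use bnd(2) in simp)
      finally have "(\<alpha> * (xi_B B)\<^sup>2 / qmax) * Y \<le> (Re l * D / qmin) * Y" by simp
      hence "\<alpha> * (xi_B B)\<^sup>2 / qmax \<le> Re l * D / qmin" by (rule mult_right_le_imp_le) (rule Y)
      thus ?thesis using q D by (simp add: field_simps)
    qed
    thus ?thesis using bnd(1,2) upper by simp
  qed
  thus ?thesis unfolding D_def qmin_def qmax_def .
qed

end

text \<open>The real matrix is regarded as a complex one, so that realness of its eigenvalues is a
  claim and not a consequence of the type.\<close>

theorem theorem1:
  fixes n m p :: nat
    and A11 A12 A21 A22 B Q :: "real mat"
    and \<gamma> \<alpha> :: real
    and lam :: complex
  assumes "n > 0" "m > 0" "p > 0"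
    and "spd n A11" and "spd m A22"
    and "A12 \<in> carrier_mat n m"
    and "A21 = - transpose_mat A12"
    and "B \<in> carrier_mat p m" and "vec_space.rank p (B :: real mat) = p"
    and "spd p Q"
    and "\<alpha> \<ge> \<gamma>" and "\<gamma> > 0"
  defines "S \<equiv> A22 + \<gamma> \<cdot>\<^sub>m (transpose_mat B * mat_inv Q * B)"
  defines "Abar \<equiv> block3 A11 A12 (0\<^sub>m n p)
                         A21 S (transpose_mat B)
                         (0\<^sub>m p n) B (0\<^sub>m p p)"
  defines "P \<equiv> block3 A11 A12 (0\<^sub>m n p)
                      (0\<^sub>m m n) S ((1 - \<gamma> / \<alpha>) \<cdot>\<^sub>m transpose_mat B)
                      (0\<^sub>m p n) B ((- 1 / \<alpha>) \<cdot>\<^sub>m Q)"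
  defines "K \<equiv> transpose_mat A12 * mat_inv A11 * A12"
  assumes "eigenvalue (map_mat complex_of_real (mat_inv P * Abar)) lam"
  shows "Im lam = 0 \<and> Re lam > 0 \<and>
    (xi_B B)\<^sup>2 * \<alpha> * lambda_min Q /
      (lambda_max Q * ((lambda_max A22 + lambda_max K) * lambda_min Q + 2 * \<alpha> * (spec_norm B)\<^sup>2))
      \<le> Re lam \<and>
    Re lam < 2 + lambda_max K / lambda_min A22"
proof -
  interpret M: saddle_point n m p A11 A12 A22 B Q \<gamma> \<alpha>
    using assms(1-12) by unfold_locales auto
  have S: "M.S = S" by (simp add: M.S_def M.T_def S_def)
  have "M.P = P" "M.Abar = Abar" "M.K = K"
    unfolding M.P_def P_def M.Abar_def Abar_def M.K_def K_def S assms(7) by (rule refl)+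
  thus ?thesis using M.eigenvalue_bounds[of lam] assms(17) by simp
qed

end
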